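(* Let $\theta\in\mathbb{R}$. The projection $P$ with entries $P_{ij}=\rho^{-2}\sum_a\widetilde u_{ia}(\widetilde u_{ja})^*$ is Murray-von Neumann equivalent to the projection $1\otimes p$ in the algebra of $4\times 4$ matrices over $\mathcal{A}(\mathrm{SL}_\theta(2,\mathbb{H}))\otimes\mathcal{A}(S^4_\theta)$ (enlarged by $\rho^{-1}$ as described in the context); that is, there exists a $4\times4$ matrix $V$ over this algebra with $P=VV^*$ and $1\otimes p=V^*V$.
   Context: Let $\theta\in\mathbb{R}$, $\mu=e^{\pi \mathrm{i}\theta}$, and let $\eta=(\eta_{ij})$ be $$\eta=\begin{pmatrix} 1&1&\bar\mu&\mu \\ 1&1&\mu&\bar\mu \\ \mu&\bar\mu&1&1 \\ \bar\mu&\mu&1&1 \end{pmatrix}.$$ **The group algebra.** $\mathcal{A}(M_\theta(2,\mathbb{H}))$ is the unital complex $*$-algebra generated by the entries of $$A_\theta=(A_{ij})=\begin{pmatrix} a_1&a_2&b_1&b_2 \\ -a_2^*&a_1^*&-b_2^*&b_1^* \\ c_1&c_2&d_1&d_2 \\ -c_2^*&c_1^*&-d_2^*&d_1^* \end{pmatrix}$$ with relations $A_{ij}A_{kl}=\eta_{ki}\eta_{jl}A_{kl}A_{ij}$. The determinant is $\det(A_\theta)=\sum_{\sigma\in S_4}(-1)^{|\sigma|}\varepsilon^{\sigma(1)\sigma(2)\sigma(3)\sigma(4)}A_{1,\sigma(1)}\cdots A_{4,\sigma(4)}$, where $\varepsilon^{ijkl}=\mu$ if $(i,j,k,l)$ is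 $(1,3,2,4)$ or one of its cyclic rotations, $\bar\mu$ if it is $(1,4,2,3)$ or one of its cyclic rotations, and $1$ for all other permutations; it is central, and $\mathcal{A}(\mathrm{SL}_\theta(2,\mathbb{H}))$ is the quotient by the ideal generated by $\det(A_\theta)-1$. **The spheres.** $\mathcal{A}(S^7_\theta)$ is the unital $*$-algebra generated by $z_1,\dots,z_4$ and adjoints, with relations expressed through the $4\times2$ matrix $$u=(u_{ia})=\begin{pmatrix} z_1&z_2 \\ -z_2^*&z_1^* \\ z_3&z_4 \\ -z_4^*&z_3^* \end{pmatrix}$$ as $u_{ia}u_{jb}=\eta_{ji}u_{jb}u_{ia}$ for all $i,j,a,b$, together with $\sum_jz_j^*z_j=1$; hence $u^*u=\mathbb{I}_2$. $p=uu^*$ is a self-adjoint idempotent, and $\mathcal{A}(S^4_\theta)\subset\mathcal{A}(S^7_\theta)$ is the $*$-subalgebra generated by the entries of $p$ (equivalently by $\alpha=2(z_1z_3^*+z_2z_4^* )$, $\beta=2(-z_1z_4+z_2z_3)$, $x=z_1z_1^*+z_2z_2^*-z_3z_3^*-z_4z_4^*$). **The family.** $\widetilde u_{ia}:=\sum_jA_{ij}\otimes u_{ja}\in\mathcal{A}(\mathrm{SL}_\theta(2,\mathbb{H}))\otimes\mathcal{A}(S^7_\theta)$, and $\mathcal{A}(\widetilde S^7_\theta)$ is the $*$-subalgebra generated by the $\widetilde u_{ia}$. There is a self-adjoint element $\rho^2$, central in $\mathcal{A}(\widetilde S^7_\theta)$, with $\sum_k(\widetilde u_{ka})^*\widetilde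 u_{kb}=\rho^2\delta_{ab}$; it lies in $\mathcal{A}(\mathrm{SL}_\theta(2,\mathbb{H}))\otimes\mathcal{A}(S^4_\theta)$. Enlargement: one adjoins to $\mathcal{A}(\mathrm{SL}_\theta(2,\mathbb{H}))\otimes\mathcal{A}(S^7_\theta)$ a self-adjoint element $\rho^{-1}$ commuting with $\mathcal{A}(\widetilde S^7_\theta)$ and such that $\rho^{-2}:=(\rho^{-1})^2$ is the inverse of $\rho^2$; the enlarged algebra $\mathcal{A}(\mathrm{SL}_\theta(2,\mathbb{H}))\otimes\mathcal{A}(S^4_\theta)$ is the $*$-subalgebra generated by $\mathcal{A}(\mathrm{SL}_\theta(2,\mathbb{H}))\otimes\mathcal{A}(S^4_\theta)$ and $\rho^{-1}$. $P$ is a projection over it. *)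

theory Defs
  imports
    Complex_Main
    "HOL-Library.Poly_Mapping"
    "HOL-Combinatorics.Permutations"
    "HOL-Algebra.Module"
    "HOL-Algebra.QuotRing"
    "HOL-Algebra.Subrings"
begin

section \<open>Complex star-algebras\<close>

text \<open>
  The algebras depend on a real parameter and are therefore carrier-based records rather than
  types.  The scalar field is always the type of complex numbers.
\<close>

record 'a star_algebra = "(complex, 'a) module" +
  adj :: "'a \<Rightarrow> 'a"

definition star_subalgebra :: "'a set \<Rightarrow> 'a star_algebra \<Rightarrow> bool" where
  "star_subalgebra B A \<longleftrightarrow>
     subring B A \<and> (\<forall>c. \<forall>x\<in>B. c \<odot>\<^bsub>A\<^esub> x \<in> B) \<and> (\<forall>x\<in>B. adj A x \<in> B)"

definition star_subalgebra_gen :: "'a star_algebra \<Rightarrow> 'a set \<Rightarrow> 'a set" where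
  "star_subalgebra_gen A S = \<Inter>{B. star_subalgebra B A \<and> S \<subseteq> B}"

text \<open>Two-sided ideals closed under the involution; they are complex subspaces because the
  algebras are unital.\<close>

definition star_ideal :: "'a set \<Rightarrow> 'a star_algebra \<Rightarrow> bool" where
  "star_ideal I A \<longleftrightarrow> ideal I A \<and> (\<forall>x\<in>I. adj A x \<in> I)"

definition star_ideal_gen :: "'a star_algebra \<Rightarrow> 'a set \<Rightarrow> 'a set" where
  "star_ideal_gen A S = \<Inter>{I. star_ideal I A \<and> S \<subseteq> I}"

definition quot_star_algebra :: "'a star_algebra \<Rightarrow> 'a set \<Rightarrow> 'a set star_algebra" where
  "quot_star_algebra A I =
     ring.extend (A Quot I)
       \<lparr>smult = (\<lambda>c X. \<Union>x\<in>X. I +>\<^bsub>A\<^esub> (c \<odot>\<^bsub>A\<^esub> x)),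
        adj = (\<lambda>X. \<Union>x\<in>X. I +>\<^bsub>A\<^esub> adj A x)\<rparr>"


section \<open>Monoid algebras, presentations and tensor products\<close>

text \<open>The complex monoid algebra of a monoid \<open>M\<close> with an anti-multiplicative involution \<open>inve\<close>,
  as finitely supported functions with convolution product.\<close>

definition monoid_star_algebra :: "'m monoid \<Rightarrow> ('m \<Rightarrow> 'm) \<Rightarrow> ('m \<Rightarrow>\<^sub>0 complex) star_algebra" where
  "monoid_star_algebra M inve =
     \<lparr>carrier = {f. Poly_Mapping.keys f \<subseteq> carrier M},
      mult = (\<lambda>f g. \<Sum>s\<in>Poly_Mapping.keys f. \<Sum>t\<in>Poly_Mapping.keys g.
                Poly_Mapping.single (s \<otimes>\<^bsub>M\<^esub> t) (Poly_Mapping.lookup f s * Poly_Mapping.lookup g t)),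
      one = Poly_Mapping.single \<one>\<^bsub>M\<^esub> 1,
      zero = 0,
      add = (+),
      smult = (\<lambda>c. Poly_Mapping.map ((*) c)),
      adj = (\<lambda>f. \<Sum>s\<in>Poly_Mapping.keys f.
                Poly_Mapping.single (inve s) (cnj (Poly_Mapping.lookup f s)))\<rparr>"

text \<open>Words in the letters \<open>(x, False)\<close> (for the generator \<open>x\<close>) and \<open>(x, True)\<close> (for its
  formal adjoint).\<close>

definition star_words :: "'g set \<Rightarrow> ('g \<times> bool) list monoid" where
  "star_words X = \<lparr>carrier = lists (X \<times> UNIV), mult = (@), one = []\<rparr>"

definition adj_word :: "('g \<times> bool) list \<Rightarrow> ('g \<times> bool) list" where
  "adj_word w = rev (map (\<lambda>(x, b). (x, \<not> b)) w)"

type_synonym 'g free_elem = "('g \<times> bool) list \<Rightarrow>\<^sub>0 complex"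

definition free_star_algebra :: "'g set \<Rightarrow> 'g free_elem star_algebra" where
  "free_star_algebra X = monoid_star_algebra (star_words X) adj_word"

definition free_gen :: "'g \<Rightarrow> 'g free_elem" where
  "free_gen x = Poly_Mapping.single [(x, False)] 1"

definition presented_star_algebra ::
    "'g set \<Rightarrow> 'g free_elem set \<Rightarrow> 'g free_elem set star_algebra" where
  "presented_star_algebra X R =
     quot_star_algebra (free_star_algebra X) (star_ideal_gen (free_star_algebra X) R)"

definition presented_gen :: "'g set \<Rightarrow> 'g free_elem set \<Rightarrow> 'g \<Rightarrow> 'g free_elem set" where
  "presented_gen X R x =
     star_ideal_gen (free_star_algebra X) R +>\<^bsub>free_star_algebra X\<^esub> free_gen x"

text \<open>
  The algebraic tensor product over the complex numbers.  The monoid algebra of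
  \<open>carrier A \<times> carrier B\<close> is the free vector space on that set with product
  \<open>(x, y) (x', y') = (x x', y y')\<close> and adjoint \<open>(x, y)* = (x*, y*)\<close>.  The linear span of
  the bilinearity relators below is stable under multiplication by pairs on either side and under
  the adjoint, so it is the star-ideal they generate.
\<close>

definition pair_star_algebra ::
    "'a star_algebra \<Rightarrow> 'b star_algebra \<Rightarrow> ('a \<times> 'b \<Rightarrow>\<^sub>0 complex) star_algebra" where
  "pair_star_algebra A B =
     monoid_star_algebra (A \<times>\<times> B) (\<lambda>(x, y). (adj A x, adj B y))"

definition tensor_relators ::
    "'a star_algebra \<Rightarrow> 'b star_algebra \<Rightarrow> ('a \<times> 'b \<Rightarrow>\<^sub>0 complex) set" where
  "tensor_relators A B =
     (let e = (\<lambda>x y. Poly_Mapping.single (x, y) (1::complex)) in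
        {e (x \<oplus>\<^bsub>A\<^esub> x') y - e x y - e x' y | x x' y.
            x \<in> carrier A \<and> x' \<in> carrier A \<and> y \<in> carrier B}
      \<union> {e x (y \<oplus>\<^bsub>B\<^esub> y') - e x y - e x y' | x y y'.
            x \<in> carrier A \<and> y \<in> carrier B \<and> y' \<in> carrier B}
      \<union> {e (c \<odot>\<^bsub>A\<^esub> x) y - Poly_Mapping.single (x, y) c | c x y.
            x \<in> carrier A \<and> y \<in> carrier B}
      \<union> {e x (c \<odot>\<^bsub>B\<^esub> y) - Poly_Mapping.single (x, y) c | c x y.
            x \<in> carrier A \<and> y \<in> carrier B})"

definition tensor_ideal ::
    "'a star_algebra \<Rightarrow> 'b star_algebra \<Rightarrow> ('a \<times> 'b \<Rightarrow>\<^sub>0 complex) set" where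
  "tensor_ideal A B = star_ideal_gen (pair_star_algebra A B) (tensor_relators A B)"

definition tensor_star_algebra ::
    "'a star_algebra \<Rightarrow> 'b star_algebra \<Rightarrow> ('a \<times> 'b \<Rightarrow>\<^sub>0 complex) set star_algebra" where
  "tensor_star_algebra A B = quot_star_algebra (pair_star_algebra A B) (tensor_ideal A B)"

definition tensor_elem ::
    "'a star_algebra \<Rightarrow> 'b star_algebra \<Rightarrow> 'a \<Rightarrow> 'b \<Rightarrow> ('a \<times> 'b \<Rightarrow>\<^sub>0 complex) set" where
  "tensor_elem A B x y = tensor_ideal A B +>\<^bsub>pair_star_algebra A B\<^esub> Poly_Mapping.single (x, y) 1"

text \<open>The image in \<open>A \<otimes> B\<close> of \<open>A \<otimes> C\<close>, for a star-subalgebra \<open>C\<close> of \<open>B\<close>.\<close>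

definition tensor_subalgebra ::
    "'a star_algebra \<Rightarrow> 'b star_algebra \<Rightarrow> 'b set \<Rightarrow> ('a \<times> 'b \<Rightarrow>\<^sub>0 complex) set set" where
  "tensor_subalgebra A B C =
     (\<lambda>f. tensor_ideal A B +>\<^bsub>pair_star_algebra A B\<^esub> f) ` {f. Poly_Mapping.keys f \<subseteq> carrier A \<times> C}"


section \<open>Adjoining an inverse square root\<close>

text \<open>
  Universal extension of \<open>T\<close> by a self-adjoint element \<open>r\<close> that commutes with the subset \<open>C\<close>
  and whose square is inverse to \<open>y\<close>.  The generators are the elements of \<open>T\<close> (as \<open>Some x\<close>) and
  \<open>r\<close> (as \<open>None\<close>); the first five families of relators make \<open>x \<mapsto> Some x\<close> a homomorphism of
  unital star-algebras.
\<close>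

definition adjoin_gens :: "'a star_algebra \<Rightarrow> 'a option set" where
  "adjoin_gens T = insert None (Some ` carrier T)"

definition adjoin_relators ::
    "'a star_algebra \<Rightarrow> 'a set \<Rightarrow> 'a \<Rightarrow> 'a option free_elem set" where
  "adjoin_relators T C y =
     (let F = free_star_algebra (adjoin_gens T);
          e = (\<lambda>x. free_gen (Some x));
          r = free_gen None
      in {e (x \<oplus>\<^bsub>T\<^esub> x') \<ominus>\<^bsub>F\<^esub> (e x \<oplus>\<^bsub>F\<^esub> e x') | x x'. x \<in> carrier T \<and> x' \<in> carrier T}
       \<union> {e (c \<odot>\<^bsub>T\<^esub> x) \<ominus>\<^bsub>F\<^esub> c \<odot>\<^bsub>F\<^esub> e x | c x. x \<in> carrier T}
       \<union> {e (x \<otimes>\<^bsub>T\<^esub> x') \<ominus>\<^bsub>F\<^esub> e x \<otimes>\<^bsub>F\<^esub> e x' | x x'. x \<in> carrier T \<and> x' \<in> carrier T}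
       \<union> {e \<one>\<^bsub>T\<^esub> \<ominus>\<^bsub>F\<^esub> \<one>\<^bsub>F\<^esub>}
       \<union> {e (adj T x) \<ominus>\<^bsub>F\<^esub> adj F (e x) | x. x \<in> carrier T}
       \<union> {adj F r \<ominus>\<^bsub>F\<^esub> r}
       \<union> {r \<otimes>\<^bsub>F\<^esub> e x \<ominus>\<^bsub>F\<^esub> e x \<otimes>\<^bsub>F\<^esub> r | x. x \<in> C}
       \<union> {(r \<otimes>\<^bsub>F\<^esub> r) \<otimes>\<^bsub>F\<^esub> e y \<ominus>\<^bsub>F\<^esub> \<one>\<^bsub>F\<^esub>, e y \<otimes>\<^bsub>F\<^esub> (r \<otimes>\<^bsub>F\<^esub> r) \<ominus>\<^bsub>F\<^esub> \<one>\<^bsub>F\<^esub>})"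

definition adjoin_inv_sqrt ::
    "'a star_algebra \<Rightarrow> 'a set \<Rightarrow> 'a \<Rightarrow> 'a option free_elem set star_algebra" where
  "adjoin_inv_sqrt T C y = presented_star_algebra (adjoin_gens T) (adjoin_relators T C y)"

definition adjoin_emb ::
    "'a star_algebra \<Rightarrow> 'a set \<Rightarrow> 'a \<Rightarrow> 'a \<Rightarrow> 'a option free_elem set" where
  "adjoin_emb T C y x = presented_gen (adjoin_gens T) (adjoin_relators T C y) (Some x)"

definition adjoin_root ::
    "'a star_algebra \<Rightarrow> 'a set \<Rightarrow> 'a \<Rightarrow> 'a option free_elem set" where
  "adjoin_root T C y = presented_gen (adjoin_gens T) (adjoin_relators T C y) None"


section \<open>Matrices and Murray-von Neumann equivalence\<close>

text \<open>A matrix is a function of a row and a column index; an \<open>n \<times> n\<close> matrix is given by its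
  values at indices in \<open>{1..n}\<close>.\<close>

type_synonym 'a matr = "nat \<Rightarrow> nat \<Rightarrow> 'a"

definition matr_carrier :: "nat \<Rightarrow> 'a star_algebra \<Rightarrow> 'a matr set" where
  "matr_carrier n A = {M. \<forall>i\<in>{1..n}. \<forall>j\<in>{1..n}. M i j \<in> carrier A}"

definition matr_eq :: "nat \<Rightarrow> 'a matr \<Rightarrow> 'a matr \<Rightarrow> bool" where
  "matr_eq n M N \<longleftrightarrow> (\<forall>i\<in>{1..n}. \<forall>j\<in>{1..n}. M i j = N i j)"

definition matr_mult :: "nat \<Rightarrow> 'a star_algebra \<Rightarrow> 'a matr \<Rightarrow> 'a matr \<Rightarrow> 'a matr" where
  "matr_mult n A M N = (\<lambda>i j. \<Oplus>\<^bsub>A\<^esub>k\<in>{1..n}. M i k \<otimes>\<^bsub>A\<^esub> N k j)"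

definition matr_adj :: "'a star_algebra \<Rightarrow> 'a matr \<Rightarrow> 'a matr" where
  "matr_adj A M = (\<lambda>i j. adj A (M j i))"

definition projection_over :: "nat \<Rightarrow> 'a star_algebra \<Rightarrow> 'a matr \<Rightarrow> bool" where
  "projection_over n A P \<longleftrightarrow>
     P \<in> matr_carrier n A \<and> matr_eq n (matr_mult n A P P) P \<and> matr_eq n (matr_adj A P) P"

definition murray_von_neumann_equiv ::
    "nat \<Rightarrow> 'a star_algebra \<Rightarrow> 'a matr \<Rightarrow> 'a matr \<Rightarrow> bool" where
  "murray_von_neumann_equiv n A P Q \<longleftrightarrow>
     projection_over n A P \<and> projection_over n A Q \<and>
     (\<exists>V\<in>matr_carrier n A.
        matr_eq n P (matr_mult n A V (matr_adj A V)) \<and>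
        matr_eq n Q (matr_mult n A (matr_adj A V) V))"


section \<open>The quantum group, the spheres and the family of projections\<close>

definition mu :: "real \<Rightarrow> complex" where
  "mu \<theta> = exp (of_real pi * \<i> * of_real \<theta>)"

definition from_rows :: "'a list list \<Rightarrow> 'a matr" where
  "from_rows rows i j = rows ! (i - 1) ! (j - 1)"

definition eta :: "real \<Rightarrow> complex matr" where
  "eta \<theta> = from_rows
     [[1, 1, cnj (mu \<theta>), mu \<theta>],
      [1, 1, mu \<theta>, cnj (mu \<theta>)],
      [mu \<theta>, cnj (mu \<theta>), 1, 1],
      [cnj (mu \<theta>), mu \<theta>, 1, 1]]"

definition eps :: "real \<Rightarrow> nat list \<Rightarrow> complex" where
  "eps \<theta> w =
     (if \<exists>n. w = rotate n [1, 3, 2, 4] then mu \<theta>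
      else if \<exists>n. w = rotate n [1, 4, 2, 3] then cnj (mu \<theta>)
      else 1)"

subsection \<open>The quantum group\<close>

datatype group_gen = GA1 | GA2 | GB1 | GB2 | GC1 | GC2 | GD1 | GD2

definition group_matr :: "'a star_algebra \<Rightarrow> (group_gen \<Rightarrow> 'a) \<Rightarrow> 'a matr" where
  "group_matr S g =
     (let neg = (\<lambda>x. \<ominus>\<^bsub>S\<^esub> x); st = adj S in from_rows
     [[g GA1, g GA2, g GB1, g GB2],
      [neg (st (g GA2)), st (g GA1), neg (st (g GB2)), st (g GB1)],
      [g GC1, g GC2, g GD1, g GD2],
      [neg (st (g GC2)), st (g GC1), neg (st (g GD2)), st (g GD1)]])"

definition group_relators :: "real \<Rightarrow> group_gen free_elem set" where
  "group_relators \<theta> =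
     (let F = free_star_algebra UNIV; a = group_matr F free_gen in
       {a i j \<otimes>\<^bsub>F\<^esub> a k l \<ominus>\<^bsub>F\<^esub> (eta \<theta> k i * eta \<theta> j l) \<odot>\<^bsub>F\<^esub> (a k l \<otimes>\<^bsub>F\<^esub> a i j) | i j k l.
          i \<in> {1..4} \<and> j \<in> {1..4} \<and> k \<in> {1..4} \<and> l \<in> {1..4}})"

definition M_alg :: "real \<Rightarrow> group_gen free_elem set star_algebra" where
  "M_alg \<theta> = presented_star_algebra UNIV (group_relators \<theta>)"

definition M_matr :: "real \<Rightarrow> group_gen free_elem set matr" where
  "M_matr \<theta> = group_matr (M_alg \<theta>) (presented_gen UNIV (group_relators \<theta>))"

definition M_det :: "real \<Rightarrow> group_gen free_elem set" where
  "M_det \<theta> =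
     (let M = M_alg \<theta>; a = M_matr \<theta> in
       \<Oplus>\<^bsub>M\<^esub>\<sigma>\<in>{\<sigma>. \<sigma> permutes {1..4::nat}}.
         (of_int (sign \<sigma>) * eps \<theta> [\<sigma> 1, \<sigma> 2, \<sigma> 3, \<sigma> 4]) \<odot>\<^bsub>M\<^esub>
           (a 1 (\<sigma> 1) \<otimes>\<^bsub>M\<^esub> a 2 (\<sigma> 2) \<otimes>\<^bsub>M\<^esub> a 3 (\<sigma> 3) \<otimes>\<^bsub>M\<^esub> a 4 (\<sigma> 4)))"

definition SL_ideal :: "real \<Rightarrow> group_gen free_elem set set" where
  "SL_ideal \<theta> = star_ideal_gen (M_alg \<theta>) {M_det \<theta> \<ominus>\<^bsub>M_alg \<theta>\<^esub> \<one>\<^bsub>M_alg \<theta>\<^esub>}"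

definition SL_alg :: "real \<Rightarrow> group_gen free_elem set set star_algebra" where
  "SL_alg \<theta> = quot_star_algebra (M_alg \<theta>) (SL_ideal \<theta>)"

definition SL_matr :: "real \<Rightarrow> group_gen free_elem set set matr" where
  "SL_matr \<theta> = (\<lambda>i j. SL_ideal \<theta> +>\<^bsub>M_alg \<theta>\<^esub> M_matr \<theta> i j)"

subsection \<open>The spheres\<close>

datatype sphere_gen = Z1 | Z2 | Z3 | Z4

definition sphere_matr :: "'a star_algebra \<Rightarrow> (sphere_gen \<Rightarrow> 'a) \<Rightarrow> 'a matr" where
  "sphere_matr S z =
     (let neg = (\<lambda>x. \<ominus>\<^bsub>S\<^esub> x); st = adj S in from_rows
     [[z Z1, z Z2],
      [neg (st (z Z2)), st (z Z1)],
      [z Z3, z Z4],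
      [neg (st (z Z4)), st (z Z3)]])"

definition sphere_relators :: "real \<Rightarrow> sphere_gen free_elem set" where
  "sphere_relators \<theta> =
     (let F = free_star_algebra UNIV; u = sphere_matr F free_gen in
       {u i a \<otimes>\<^bsub>F\<^esub> u j b \<ominus>\<^bsub>F\<^esub> eta \<theta> j i \<odot>\<^bsub>F\<^esub> (u j b \<otimes>\<^bsub>F\<^esub> u i a) | i j a b.
          i \<in> {1..4} \<and> j \<in> {1..4} \<and> a \<in> {1..2} \<and> b \<in> {1..2}}
       \<union> {(\<Oplus>\<^bsub>F\<^esub>z\<in>{Z1, Z2, Z3, Z4}. adj F (free_gen z) \<otimes>\<^bsub>F\<^esub> free_gen z) \<ominus>\<^bsub>F\<^esub> \<one>\<^bsub>F\<^esub>})"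

definition S7_alg :: "real \<Rightarrow> sphere_gen free_elem set star_algebra" where
  "S7_alg \<theta> = presented_star_algebra UNIV (sphere_relators \<theta>)"

definition S7_matr :: "real \<Rightarrow> sphere_gen free_elem set matr" where
  "S7_matr \<theta> = sphere_matr (S7_alg \<theta>) (presented_gen UNIV (sphere_relators \<theta>))"

definition p_matr :: "real \<Rightarrow> sphere_gen free_elem set matr" where
  "p_matr \<theta> =
     (let S = S7_alg \<theta>; u = S7_matr \<theta> in
       (\<lambda>i j. \<Oplus>\<^bsub>S\<^esub>a\<in>{1..2}. u i a \<otimes>\<^bsub>S\<^esub> adj S (u j a)))"

definition S4_carrier :: "real \<Rightarrow> sphere_gen free_elem set set" where
  "S4_carrier \<theta> =
     star_subalgebra_gen (S7_alg \<theta>) {p_matr \<theta> i j | i j. i \<in> {1..4} \<and> j \<in> {1..4}}"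

subsection \<open>The family of projections\<close>

type_synonym SL_S7_elem =
  "(group_gen free_elem set set \<times> sphere_gen free_elem set \<Rightarrow>\<^sub>0 complex) set"

definition SL_S7_alg :: "real \<Rightarrow> SL_S7_elem star_algebra" where
  "SL_S7_alg \<theta> = tensor_star_algebra (SL_alg \<theta>) (S7_alg \<theta>)"

definition ut_matr :: "real \<Rightarrow> SL_S7_elem matr" where
  "ut_matr \<theta> = (\<lambda>i a. \<Oplus>\<^bsub>SL_S7_alg \<theta>\<^esub>j\<in>{1..4}.
     tensor_elem (SL_alg \<theta>) (S7_alg \<theta>) (SL_matr \<theta> i j) (S7_matr \<theta> j a))"

definition S7t_carrier :: "real \<Rightarrow> SL_S7_elem set" where
  "S7t_carrier \<theta> =
     star_subalgebra_gen (SL_S7_alg \<theta>) {ut_matr \<theta> i a | i a. i \<in> {1..4} \<and> a \<in> {1..2}}"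

text \<open>The element \<open>rho2\<close> is determined by \<open>\<Sum>\<^sub>k (ut k a)* (ut k b) = rho2 \<delta>\<^sub>a\<^sub>b\<close>; the case
  \<open>a = b = 1\<close> serves as its definition.\<close>

definition rho2 :: "real \<Rightarrow> SL_S7_elem" where
  "rho2 \<theta> =
     (let T = SL_S7_alg \<theta> in
       \<Oplus>\<^bsub>T\<^esub>k\<in>{1..4}. adj T (ut_matr \<theta> k 1) \<otimes>\<^bsub>T\<^esub> ut_matr \<theta> k 1)"

type_synonym SL_S7_ext_elem = "SL_S7_elem option free_elem set"

definition SL_S7_ext_alg :: "real \<Rightarrow> SL_S7_ext_elem star_algebra" where
  "SL_S7_ext_alg \<theta> = adjoin_inv_sqrt (SL_S7_alg \<theta>) (S7t_carrier \<theta>) (rho2 \<theta>)"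

definition ext_emb :: "real \<Rightarrow> SL_S7_elem \<Rightarrow> SL_S7_ext_elem" where
  "ext_emb \<theta> = adjoin_emb (SL_S7_alg \<theta>) (S7t_carrier \<theta>) (rho2 \<theta>)"

definition rho_inv :: "real \<Rightarrow> SL_S7_ext_elem" where
  "rho_inv \<theta> = adjoin_root (SL_S7_alg \<theta>) (S7t_carrier \<theta>) (rho2 \<theta>)"

definition SL_S4_ext_alg :: "real \<Rightarrow> SL_S7_ext_elem star_algebra" where
  "SL_S4_ext_alg \<theta> =
     (let E = SL_S7_ext_alg \<theta> in
       E\<lparr>carrier := star_subalgebra_gen E
           (insert (rho_inv \<theta>)
             (ext_emb \<theta> ` tensor_subalgebra (SL_alg \<theta>) (S7_alg \<theta>) (S4_carrier \<theta>)))\<rparr>)"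

definition P_matr :: "real \<Rightarrow> SL_S7_ext_elem matr" where
  "P_matr \<theta> =
     (let E = SL_S7_ext_alg \<theta>; ut = (\<lambda>i a. ext_emb \<theta> (ut_matr \<theta> i a)) in
       (\<lambda>i j. (rho_inv \<theta> \<otimes>\<^bsub>E\<^esub> rho_inv \<theta>) \<otimes>\<^bsub>E\<^esub> (\<Oplus>\<^bsub>E\<^esub>a\<in>{1..2}. ut i a \<otimes>\<^bsub>E\<^esub> adj E (ut j a))))"

definition one_tensor_p :: "real \<Rightarrow> SL_S7_ext_elem matr" where
  "one_tensor_p \<theta> = (\<lambda>i j.
     ext_emb \<theta> (tensor_elem (SL_alg \<theta>) (S7_alg \<theta>) \<one>\<^bsub>SL_alg \<theta>\<^esub> (p_matr \<theta> i j)))"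

end

theory Submission
  imports Defs
begin

text \<open>
  The matrix \<open>ut = A u\<close> inherits from \<open>A\<close> and \<open>u\<close> both the block form of a matrix of quaternions and
  the commutation relations \<open>ut i a ut j b = eta j i (ut j b ut i a)\<close>: the phases \<open>eta k l\<close> coming
  from \<open>A\<close> cancel the phases \<open>eta l k\<close> coming from \<open>u\<close>.  These two properties alone force the columns
  to be orthogonal and of equal norm, so \<open>ut* ut\<close> is the scalar matrix \<open>rho2\<close>, just as \<open>u* u = 1\<close>.
  As \<open>rho_inv\<close> is self-adjoint and commutes with \<open>ut\<close>, both \<open>W = rho_inv ut\<close> and \<open>U = 1 \<otimes> u\<close> are
  isometries, with range projections \<open>P\<close> and \<open>1 \<otimes> p\<close>, and \<open>V = W U*\<close> is the partial isometry between
  them.  Its entries \<open>rho_inv \<Sum>\<^sub>j A i j \<otimes> p j l\<close> involve \<open>u\<close> only through \<open>p\<close>, hence lie in the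
  algebra over the four-sphere.
\<close>

section \<open>Star-algebras, homomorphisms and quotients\<close>

text \<open>The entries of \<open>W\<close> and \<open>U\<close> need not lie in the algebra over
  the four-sphere, so the usual argument for the equivalence of range projections is not run inside
  that algebra. It is carried out with 4 by 2 matrices over the ambient
  \<open>SL_S7_ext_alg\<close>, and only the entries of \<open>V\<close> are located in the
  subalgebra. Those of \<open>P\<close> and \<open>1 \<otimes> p\<close> follow, being entries of
  \<open>V V*\<close> and \<open>V* V\<close>.

  The order of the factors in \<open>V\<close> matters: the relators make \<open>rho_inv\<close>
  commute with the algebra generated by \<open>ut\<close>, but impose no such relation with
  \<open>1 \<otimes> u\<close>. In \<open>rho_inv ut U*\<close> it already stands on the left and
  never has to pass an entry of \<open>U*\<close>.

  The block form and the commutation relations are equations between elements, so they survive every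
  homomorphism of star-algebras. They are therefore read off from relators in a free algebra and
  carried through the chain of quotients and into the tensor product; no normal forms are
  involved.\<close>

locale star_alg = ring A for A :: "'a star_algebra" (structure) +
  assumes smult_closed [intro, simp]: "x \<in> carrier A \<Longrightarrow> c \<odot> x \<in> carrier A"
    and smult_add: "\<lbrakk>x \<in> carrier A; y \<in> carrier A\<rbrakk> \<Longrightarrow> c \<odot> (x \<oplus> y) = c \<odot> x \<oplus> c \<odot> y"
    and add_smult: "x \<in> carrier A \<Longrightarrow> (c + d) \<odot> x = c \<odot> x \<oplus> d \<odot> x"
    and smult_smult: "x \<in> carrier A \<Longrightarrow> c \<odot> (d \<odot> x) = (c * d) \<odot> x"
    and one_smult [simp]: "x \<in> carrier A \<Longrightarrow> 1 \<odot> x = x"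
    and mult_smult_left: "\<lbrakk>x \<in> carrier A; y \<in> carrier A\<rbrakk> \<Longrightarrow> (c \<odot> x) \<otimes> y = c \<odot> (x \<otimes> y)"
    and mult_smult_right: "\<lbrakk>x \<in> carrier A; y \<in> carrier A\<rbrakk> \<Longrightarrow> x \<otimes> (c \<odot> y) = c \<odot> (x \<otimes> y)"
    and adj_closed [intro, simp]: "x \<in> carrier A \<Longrightarrow> adj A x \<in> carrier A"
    and adj_add: "\<lbrakk>x \<in> carrier A; y \<in> carrier A\<rbrakk> \<Longrightarrow> adj A (x \<oplus> y) = adj A x \<oplus> adj A y"
    and adj_smult: "x \<in> carrier A \<Longrightarrow> adj A (c \<odot> x) = cnj c \<odot> adj A x"
    and adj_mult: "\<lbrakk>x \<in> carrier A; y \<in> carrier A\<rbrakk> \<Longrightarrow> adj A (x \<otimes> y) = adj A y \<otimes> adj A x"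
    and adj_adj [simp]: "x \<in> carrier A \<Longrightarrow> adj A (adj A x) = x"
begin

lemma adj_zero [simp]: "adj A \<zero> = \<zero>"
  by (metis adj_add adj_closed add.l_cancel_one zero_closed l_zero)

lemma adj_uminus: "x \<in> carrier A \<Longrightarrow> adj A (\<ominus> x) = \<ominus> adj A x"
  by (metis a_inv_closed adj_add adj_closed adj_zero local.minus_unique r_neg)

lemma adj_one [simp]: "adj A \<one> = \<one>"
  by (metis adj_adj adj_closed adj_mult one_closed r_one)

lemma adj_finsum:
  assumes "finite S" "f \<in> S \<rightarrow> carrier A"
  shows "adj A (finsum A f S) = finsum A (\<lambda>k. adj A (f k)) S"
  using assms
  by (induction S) (auto simp: finsum_insert adj_add Pi_iff)

lemma star_ideal_carrier: "star_ideal (carrier A) A"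
  by (auto simp: star_ideal_def oneideal)

text \<open>Since \<open>S\<close> lies in the carrier, the whole algebra belongs to the intersected
  family. An empty family would intersect to the universe of the type, which need not be an
  ideal.\<close>

lemma star_ideal_gen:
  assumes "S \<subseteq> carrier A"
  shows "star_ideal (star_ideal_gen A S) A"
proof -
  have "carrier A \<in> {I. star_ideal I A \<and> S \<subseteq> I}"
    using assms star_ideal_carrier by auto
  then have "{I. star_ideal I A \<and> S \<subseteq> I} \<noteq> {}" by blast
  from i_Intersect[OF _ this] show ?thesis
    by (auto simp: star_ideal_def star_ideal_gen_def)
qed

lemma star_ideal_gen_superset: "S \<subseteq> star_ideal_gen A S"
  by (auto simp: star_ideal_gen_def)

lemma star_subalgebra_carrier: "star_subalgebra (carrier A) A"
  by (auto simp: star_subalgebra_def carrier_is_subring)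

lemma star_subalgebra_gen:
  assumes "S \<subseteq> carrier A"
  shows "star_subalgebra (star_subalgebra_gen A S) A"
proof -
  have "carrier A \<in> {I. star_subalgebra I A \<and> S \<subseteq> I}"
    using assms star_subalgebra_carrier by auto
  then have "{I. star_subalgebra I A \<and> S \<subseteq> I} \<noteq> {}" by blast
  from subring_Inter[OF _ this] show ?thesis
    by (auto simp: star_subalgebra_def star_subalgebra_gen_def)
qed

lemma star_subalgebra_gen_superset: "S \<subseteq> star_subalgebra_gen A S"
  by (auto simp: star_subalgebra_gen_def)

end

locale star_alg_hom = A?: star_alg A + B?: star_alg B + ring_hom_ring A B h
  for A :: "'a star_algebra" (structure) and B :: "'b star_algebra" (structure) and h +
  assumes hom_smult [simp]: "x \<in> carrier A \<Longrightarrow> h (c \<odot>\<^bsub>A\<^esub> x) = c \<odot>\<^bsub>B\<^esub> h x"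
    and hom_adj [simp]: "x \<in> carrier A \<Longrightarrow> h (adj A x) = adj B (h x)"
begin

text \<open>Relators are written as differences; this turns a relator that is mapped to zero into an
  equation in the target.\<close>

lemma hom_eq_if_minus_eq_zero:
  assumes "h (x \<ominus>\<^bsub>A\<^esub> y) = \<zero>\<^bsub>B\<^esub>" "x \<in> carrier A" "y \<in> carrier A"
  shows "h x = h y"
proof -
  have "h x \<ominus>\<^bsub>B\<^esub> h y = \<zero>\<^bsub>B\<^esub>"
    using assms by (simp add: A.minus_eq B.minus_eq)
  then show ?thesis using assms by simp
qed

end

lemma star_subalgebra_subset: "star_subalgebra B A \<Longrightarrow> B \<subseteq> carrier A"
  unfolding star_subalgebra_def using subringE(1) by blast

lemma quot_star_algebra_simps:
  "carrier (quot_star_algebra A I) = carrier (A Quot I)"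
  "mult (quot_star_algebra A I) = mult (A Quot I)"
  "one (quot_star_algebra A I) = one (A Quot I)"
  "zero (quot_star_algebra A I) = zero (A Quot I)"
  "add (quot_star_algebra A I) = add (A Quot I)"
  "smult (quot_star_algebra A I) = (\<lambda>c X. \<Union>x\<in>X. I +>\<^bsub>A\<^esub> (c \<odot>\<^bsub>A\<^esub> x))"
  "adj (quot_star_algebra A I) = (\<lambda>X. \<Union>x\<in>X. I +>\<^bsub>A\<^esub> adj A x)"
  by (simp_all add: quot_star_algebra_def ring.defs)

lemma carrier_FactRing: "carrier (A Quot I) = (+>\<^bsub>A\<^esub>) I ` carrier A"
  by (auto simp: FactRing_def A_RCOSETS_def')

text \<open>The scalar action and the adjoint of a quotient are defined as unions over all
  representatives. An additive map that preserves the ideal sends congruent elements to congruent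
  ones, so all sets in the union coincide.\<close>

lemma (in ideal) coset_map_UN:
  assumes "\<And>x y. x \<in> carrier R \<Longrightarrow> y \<in> carrier R \<Longrightarrow> f (x \<oplus> y) = f x \<oplus> f y"
    and "\<And>x. x \<in> carrier R \<Longrightarrow> f x \<in> carrier R" "\<And>x. x \<in> I \<Longrightarrow> f x \<in> I"
    and x: "x \<in> carrier R"
  shows "(\<Union>y\<in>I +> x. I +> f y) = I +> f x"
proof -
  have "I +> f y = I +> f x" if y: "y \<in> I +> x" for y
  proof -
    obtain i where i: "i \<in> I" "y = i \<oplus> x" using y by (auto simp: a_r_coset_def')
    then have "f y = f i \<oplus> f x" using assms by simp
    then have "f y \<in> I +> f x" using i assms(3) by (auto simp: a_r_coset_def')
    then show ?thesis
      using a_repr_independence' assms(2)[OF x] by blast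
  qed
  moreover have "x \<in> I +> x" using x
    by (simp add: a_rcos_self)
  ultimately show ?thesis by blast
qed

text \<open>Every element of the quotient is a projected element and the projection respects all
  operations, so each axiom is the image of the same axiom in \<open>A\<close>.\<close>

lemma (in star_alg) quot_star_alg_hom:
  assumes I: "star_ideal I A"
  shows "star_alg_hom A (quot_star_algebra A I) ((+>) I)"
proof -
  interpret I: ideal I A using I by (simp add: star_ideal_def)
  let ?Q = "quot_star_algebra A I" and ?p = "(+>) I"
  \<comment> \<open>\<open>A Quot I\<close> and the quotient star-algebra are records of different
    types, so neither can be rewritten to the other. The ring axioms are unfolded to statements
    about the fields, which agree.\<close>
  have ringQ: "ring ?Q"
    using I.quotient_is_ring
    unfolding ring_def abelian_group_def abelian_monoid_def abelian_group_axioms_def Group.monoid_def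
      ring_axioms_def comm_group_def comm_monoid_def comm_monoid_axioms_def group_def
      group_axioms_def Units_def quot_star_algebra_simps partial_object.simps monoid.simps .
  have "ring_hom_ring A ?Q ?p"
    using I.rcos_ring_hom ringQ
    by (auto intro!: ring_hom_ringI2 ring_axioms simp: ring_hom_def quot_star_algebra_simps)
  then interpret p: ring_hom_ring A ?Q ?p .
  \<comment> \<open>In a unital algebra a scalar acts as multiplication by
    \<open>c \<odot> \<one>\<close>, so ring ideals are closed under scalars.\<close>
  have smI: "c \<odot> x \<in> I" if "x \<in> I" for c x
  proof -
    have "(c \<odot> \<one>) \<otimes> x = c \<odot> x" using that by (simp add: mult_smult_left)
    then show ?thesis using I.I_l_closed[OF that, of "c \<odot> \<one>"] by simp
  qed
  have sm: "c \<odot>\<^bsub>?Q\<^esub> ?p x = ?p (c \<odot> x)" if "x \<in> carrier A" for c x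
    using I.coset_map_UN[of "\<lambda>x. c \<odot> x" x] that smI
    by (simp add: quot_star_algebra_simps smult_add)
  have ad: "adj ?Q (?p x) = ?p (adj A x)" if "x \<in> carrier A" for x
    using I.coset_map_UN[of "adj A" x] that I
    by (simp add: quot_star_algebra_simps adj_add star_ideal_def)
  have car: "carrier ?Q = ?p ` carrier A"
    by (simp add: quot_star_algebra_simps carrier_FactRing)
  have E: "\<exists>x\<in>carrier A. X = ?p x" if "X \<in> carrier ?Q" for X
    using that car by auto
  note hom = p.hom_add[symmetric] p.hom_mult[symmetric] sm ad
  interpret Q: star_alg ?Q
  proof (intro star_alg.intro star_alg_axioms.intro ringQ)
    fix c d X assume "X \<in> carrier ?Q"
    with E obtain x where [simp]: "x \<in> carrier A" "X = ?p x" by blast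
    show "c \<odot>\<^bsub>?Q\<^esub> X \<in> carrier ?Q" "(c + d) \<odot>\<^bsub>?Q\<^esub> X = c \<odot>\<^bsub>?Q\<^esub> X \<oplus>\<^bsub>?Q\<^esub> d \<odot>\<^bsub>?Q\<^esub> X"
      "c \<odot>\<^bsub>?Q\<^esub> (d \<odot>\<^bsub>?Q\<^esub> X) = (c * d) \<odot>\<^bsub>?Q\<^esub> X" "1 \<odot>\<^bsub>?Q\<^esub> X = X"
      "adj ?Q X \<in> carrier ?Q" "adj ?Q (c \<odot>\<^bsub>?Q\<^esub> X) = cnj c \<odot>\<^bsub>?Q\<^esub> adj ?Q X"
      "adj ?Q (adj ?Q X) = X"
      by (simp_all add: hom adj_smult add_smult smult_smult del: p.hom_add p.hom_mult)
    fix Y assume "Y \<in> carrier ?Q"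
    with E obtain y where [simp]: "y \<in> carrier A" "Y = ?p y" by blast
    show "c \<odot>\<^bsub>?Q\<^esub> (X \<oplus>\<^bsub>?Q\<^esub> Y) = c \<odot>\<^bsub>?Q\<^esub> X \<oplus>\<^bsub>?Q\<^esub> c \<odot>\<^bsub>?Q\<^esub> Y"
      "(c \<odot>\<^bsub>?Q\<^esub> X) \<otimes>\<^bsub>?Q\<^esub> Y = c \<odot>\<^bsub>?Q\<^esub> (X \<otimes>\<^bsub>?Q\<^esub> Y)" "X \<otimes>\<^bsub>?Q\<^esub> (c \<odot>\<^bsub>?Q\<^esub> Y) = c \<odot>\<^bsub>?Q\<^esub> (X \<otimes>\<^bsub>?Q\<^esub> Y)"
      "adj ?Q (X \<oplus>\<^bsub>?Q\<^esub> Y) = adj ?Q X \<oplus>\<^bsub>?Q\<^esub> adj ?Q Y"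
      "adj ?Q (X \<otimes>\<^bsub>?Q\<^esub> Y) = adj ?Q Y \<otimes>\<^bsub>?Q\<^esub> adj ?Q X"
      by (simp_all add: hom adj_mult adj_add smult_add mult_smult_left mult_smult_right
          del: p.hom_add p.hom_mult)
  qed
  show ?thesis
    by unfold_locales (simp_all add: sm ad)
qed

lemma (in star_alg) quot_zero:
  assumes I: "star_ideal I A" and x: "x \<in> I"
  shows "I +> x = \<zero>\<^bsub>quot_star_algebra A I\<^esub>"
proof -
  interpret I: ideal I A using I by (simp add: star_ideal_def)
  show ?thesis
    using x I.a_rcos_const by (simp add: quot_star_algebra_simps FactRing_def)
qed

lemma (in star_alg) quot_gen_hom:
  assumes S: "S \<subseteq> carrier A"
  defines "I \<equiv> star_ideal_gen A S"
  shows "star_alg_hom A (quot_star_algebra A I) ((+>) I)"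
    and "\<And>x. x \<in> S \<Longrightarrow> I +> x = \<zero>\<^bsub>quot_star_algebra A I\<^esub>"
  using quot_star_alg_hom quot_zero star_ideal_gen[OF S] star_ideal_gen_superset
  unfolding I_def by blast+

section \<open>Monoid algebras and presentations\<close>

text \<open>A finitely supported function is the sum of its monomials. Carrying the support
  condition through the induction reduces identities additive in \<open>f\<close> to monomials whose
  key lies in \<open>X\<close>.\<close>

lemma keys_subset_induct [consumes 1, case_names zero add single]:
  fixes f :: "'a \<Rightarrow>\<^sub>0 'b::comm_monoid_add"
  assumes f: "Poly_Mapping.keys f \<subseteq> X"
    and zero: "P 0" and add: "\<And>f g. \<lbrakk>Poly_Mapping.keys f \<subseteq> X; Poly_Mapping.keys g \<subseteq> X; P f; P g\<rbrakk> \<Longrightarrow> P (f + g)"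
    and single: "\<And>s c. s \<in> X \<Longrightarrow> P (Poly_Mapping.single s c)"
  shows "P f"
proof -
  have "Poly_Mapping.keys (\<Sum>s\<in>K. Poly_Mapping.single s (Poly_Mapping.lookup f s)) \<subseteq> X \<and>
    P (\<Sum>s\<in>K. Poly_Mapping.single s (Poly_Mapping.lookup f s))"
    if "K \<subseteq> X" "finite K" for K
    using that(2,1)
  proof (induction K)
    case (insert s K)
    then have "Poly_Mapping.keys (Poly_Mapping.single s (Poly_Mapping.lookup f s)) \<subseteq> X" by auto
    moreover from this have "Poly_Mapping.keys (Poly_Mapping.single s (Poly_Mapping.lookup f s)
        + (\<Sum>s\<in>K. Poly_Mapping.single s (Poly_Mapping.lookup f s))) \<subseteq> X"
      using insert by (intro order_trans[OF keys_add]) auto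
    ultimately show ?case using insert by (auto intro!: add single)
  qed (simp add: zero)
  from this[OF f finite_keys]
  have "P (\<Sum>s\<in>Poly_Mapping.keys f. Poly_Mapping.single s (Poly_Mapping.lookup f s))"
    by blast
  also have "(\<Sum>s\<in>Poly_Mapping.keys f. Poly_Mapping.single s (Poly_Mapping.lookup f s)) = f"
    by (rule poly_mapping_eqI) (simp add: lookup_sum lookup_single when_def in_keys_iff)
  finally show ?thesis .
qed

locale star_monoid = monoid M for M :: "'m monoid" (structure) +
  fixes inve :: "'m \<Rightarrow> 'm"
  assumes inve_closed [simp]: "x \<in> carrier M \<Longrightarrow> inve x \<in> carrier M"
    and inve_mult: "\<lbrakk>x \<in> carrier M; y \<in> carrier M\<rbrakk> \<Longrightarrow> inve (x \<otimes> y) = inve y \<otimes> inve x"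
    and inve_inve [simp]: "x \<in> carrier M \<Longrightarrow> inve (inve x) = x"

lemma monoid_star_algebra_simps:
  "carrier (monoid_star_algebra M inve) = {f. Poly_Mapping.keys f \<subseteq> carrier M}"
  "one (monoid_star_algebra M inve) = Poly_Mapping.single \<one>\<^bsub>M\<^esub> 1"
  "zero (monoid_star_algebra M inve) = 0"
  "add (monoid_star_algebra M inve) = (+)"
  "smult (monoid_star_algebra M inve) = (\<lambda>c. Poly_Mapping.map ((*) c))"
  by (simp_all add: monoid_star_algebra_def)

lemma monoid_star_algebra_mult_single [simp]:
  "Poly_Mapping.single s c \<otimes>\<^bsub>monoid_star_algebra M inve\<^esub> Poly_Mapping.single t d
     = Poly_Mapping.single (s \<otimes>\<^bsub>M\<^esub> t) (c * d)"
  by (simp add: monoid_star_algebra_def)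

lemma monoid_star_algebra_adj_single [simp]:
  "adj (monoid_star_algebra M inve) (Poly_Mapping.single s c) = Poly_Mapping.single (inve s) (cnj c)"
  by (simp add: monoid_star_algebra_def)

lemma monoid_star_algebra_smult_single [simp]:
  "c \<odot>\<^bsub>monoid_star_algebra M inve\<^esub> Poly_Mapping.single s d = Poly_Mapping.single s (c * d)"
  by (simp add: monoid_star_algebra_def)

text \<open>Cancellation can make the support of \<open>f + g\<close> smaller than the union of the
  two supports. The sums over keys still add up because the summand is additive in the coefficient
  and vanishes at coefficient 0.\<close>

lemma monoid_star_algebra_mult_add:
  "(f + g) \<otimes>\<^bsub>monoid_star_algebra M inve\<^esub> k
     = f \<otimes>\<^bsub>monoid_star_algebra M inve\<^esub> k + g \<otimes>\<^bsub>monoid_star_algebra M inve\<^esub> k"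
  "k \<otimes>\<^bsub>monoid_star_algebra M inve\<^esub> (f + g)
     = k \<otimes>\<^bsub>monoid_star_algebra M inve\<^esub> f + k \<otimes>\<^bsub>monoid_star_algebra M inve\<^esub> g"
proof -
  show "(f + g) \<otimes>\<^bsub>monoid_star_algebra M inve\<^esub> k
     = f \<otimes>\<^bsub>monoid_star_algebra M inve\<^esub> k + g \<otimes>\<^bsub>monoid_star_algebra M inve\<^esub> k"
    unfolding monoid_star_algebra_def monoid.simps
    by (rule setsum_keys_plus_distrib) (simp_all add: distrib_right single_add sum.distrib)
  show "k \<otimes>\<^bsub>monoid_star_algebra M inve\<^esub> (f + g)
     = k \<otimes>\<^bsub>monoid_star_algebra M inve\<^esub> f + k \<otimes>\<^bsub>monoid_star_algebra M inve\<^esub> g"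
    unfolding monoid_star_algebra_def monoid.simps sum.distrib[symmetric]
    by (intro sum.cong refl setsum_keys_plus_distrib) (simp_all add: distrib_left single_add)
qed

lemma monoid_star_algebra_mult_zero [simp]:
  "0 \<otimes>\<^bsub>monoid_star_algebra M inve\<^esub> k = 0" "k \<otimes>\<^bsub>monoid_star_algebra M inve\<^esub> 0 = 0"
  by (simp_all add: monoid_star_algebra_def)

lemma monoid_star_algebra_smult_add:
  "c \<odot>\<^bsub>monoid_star_algebra M inve\<^esub> (f + g)
     = (c \<odot>\<^bsub>monoid_star_algebra M inve\<^esub> f) + (c \<odot>\<^bsub>monoid_star_algebra M inve\<^esub> g)"
  "(c + d) \<odot>\<^bsub>monoid_star_algebra M inve\<^esub> f
     = (c \<odot>\<^bsub>monoid_star_algebra M inve\<^esub> f) + (d \<odot>\<^bsub>monoid_star_algebra M inve\<^esub> f)"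
  "c \<odot>\<^bsub>monoid_star_algebra M inve\<^esub> 0 = 0"
  by (simp_all add: monoid_star_algebra_def poly_mapping_eq_iff fun_eq_iff map.rep_eq lookup_add
      distrib_left distrib_right when_def
      flip: distrib_left)

lemma monoid_star_algebra_adj_add:
  "adj (monoid_star_algebra M inve) (f + g)
     = adj (monoid_star_algebra M inve) f + adj (monoid_star_algebra M inve) g"
  "adj (monoid_star_algebra M inve) 0 = 0"
  by (simp_all add: monoid_star_algebra_def)
    (rule setsum_keys_plus_distrib, simp_all add: single_add)

context star_monoid
begin

lemma inve_one [simp]: "inve \<one> = \<one>"
  by (metis inve_closed inve_inve inve_mult one_closed r_one)

text \<open>Both sides of each multiplicative or adjoint axiom are additive in every argument, so it
  is enough to check monomials, where the axiom is one of the monoid, of \<open>inve\<close>, or of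
  complex numbers with \<open>cnj\<close>.\<close>

lemma star_alg_monoid_star_algebra: "star_alg (monoid_star_algebra M inve)"
proof -
  let ?A = "monoid_star_algebra M inve"
  note simps = monoid_star_algebra_simps
  note adds = monoid_star_algebra_mult_add monoid_star_algebra_smult_add monoid_star_algebra_adj_add
  have add_keys: "Poly_Mapping.keys (f + g) \<subseteq> carrier M"
    if "Poly_Mapping.keys f \<subseteq> carrier M" "Poly_Mapping.keys g \<subseteq> carrier M"
    for f g :: "'m \<Rightarrow>\<^sub>0 complex"
    using that keys_add[of f g] by blast
  have mult_keys: "Poly_Mapping.keys (f \<otimes>\<^bsub>?A\<^esub> g) \<subseteq> carrier M"
    if "Poly_Mapping.keys f \<subseteq> carrier M" "Poly_Mapping.keys g \<subseteq> carrier M" for f g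
    using that(1)
  proof (induction f rule: keys_subset_induct)
    case (single s c)
    show ?case using that(2)
      by (induction g rule: keys_subset_induct) (use single in \<open>simp_all add: adds add_keys\<close>)
  qed (simp_all add: adds add_keys)
  have assoc: "(f \<otimes>\<^bsub>?A\<^esub> g) \<otimes>\<^bsub>?A\<^esub> k = f \<otimes>\<^bsub>?A\<^esub> (g \<otimes>\<^bsub>?A\<^esub> k)"
    if "Poly_Mapping.keys f \<subseteq> carrier M" "Poly_Mapping.keys g \<subseteq> carrier M"
      "Poly_Mapping.keys k \<subseteq> carrier M" for f g k
    using that(1)
  proof (induction f rule: keys_subset_induct)
    case (single s c)
    show ?case using that(2)
    proof (induction g rule: keys_subset_induct)
      case (single t d)
      show ?case using that(3)
        by (induction k rule: keys_subset_induct)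
          (use \<open>s \<in> carrier M\<close> \<open>t \<in> carrier M\<close> in \<open>simp_all add: adds m_assoc mult.assoc\<close>)
    qed (simp_all add: adds)
  qed (simp_all add: adds)
  have unit: "f \<otimes>\<^bsub>?A\<^esub> \<one>\<^bsub>?A\<^esub> = f \<and> \<one>\<^bsub>?A\<^esub> \<otimes>\<^bsub>?A\<^esub> f = f"
    if "Poly_Mapping.keys f \<subseteq> carrier M" for f
    using that by (induction f rule: keys_subset_induct) (simp_all add: adds simps)
  have "abelian_group ?A"
  proof (rule abelian_groupI)
    fix x assume "x \<in> carrier ?A"
    then show "\<exists>y\<in>carrier ?A. y \<oplus>\<^bsub>?A\<^esub> x = \<zero>\<^bsub>?A\<^esub>"
      by (auto simp: simps in_keys_iff subset_iff intro!: exI[of _ "- x"])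
  qed (auto simp: simps dest: subsetD[OF keys_add])
  moreover have "Group.monoid ?A"
    by (rule monoidI) (use mult_keys assoc unit in \<open>auto simp: simps\<close>)
  ultimately have "ring ?A"
    by (intro ringI) (auto simp: simps adds)
  then show ?thesis
  proof (intro star_alg.intro star_alg_axioms.intro)
    fix c d :: complex and x assume x: "x \<in> carrier ?A"
    then have k: "Poly_Mapping.keys x \<subseteq> carrier M" by (simp add: simps)
    have "c \<odot>\<^bsub>?A\<^esub> x \<in> carrier ?A \<and> c \<odot>\<^bsub>?A\<^esub> (d \<odot>\<^bsub>?A\<^esub> x) = (c * d) \<odot>\<^bsub>?A\<^esub> x
      \<and> 1 \<odot>\<^bsub>?A\<^esub> x = x \<and> adj ?A x \<in> carrier ?A \<and> adj ?A (c \<odot>\<^bsub>?A\<^esub> x) = cnj c \<odot>\<^bsub>?A\<^esub> adj ?A x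
      \<and> adj ?A (adj ?A x) = x"
      using k
    proof (induction x rule: keys_subset_induct)
      case (add f g)
      then show ?case by (simp add: adds) (simp add: simps add_keys)
    next
      case (single s e)
      then show ?case by (simp add: mult.assoc) (simp add: simps)
    qed (simp_all add: adds, simp_all add: simps)
    then show "c \<odot>\<^bsub>?A\<^esub> x \<in> carrier ?A" "c \<odot>\<^bsub>?A\<^esub> (d \<odot>\<^bsub>?A\<^esub> x) = (c * d) \<odot>\<^bsub>?A\<^esub> x"
      "1 \<odot>\<^bsub>?A\<^esub> x = x" "adj ?A x \<in> carrier ?A" "adj ?A (c \<odot>\<^bsub>?A\<^esub> x) = cnj c \<odot>\<^bsub>?A\<^esub> adj ?A x"
      "adj ?A (adj ?A x) = x" by blast+
    show "(c + d) \<odot>\<^bsub>?A\<^esub> x = (c \<odot>\<^bsub>?A\<^esub> x) \<oplus>\<^bsub>?A\<^esub> (d \<odot>\<^bsub>?A\<^esub> x)"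
      by (simp add: adds simps(4))
    fix y assume y: "y \<in> carrier ?A"
    then have l: "Poly_Mapping.keys y \<subseteq> carrier M" by (simp add: simps)
    show "c \<odot>\<^bsub>?A\<^esub> (x \<oplus>\<^bsub>?A\<^esub> y) = (c \<odot>\<^bsub>?A\<^esub> x) \<oplus>\<^bsub>?A\<^esub> (c \<odot>\<^bsub>?A\<^esub> y)"
      "adj ?A (x \<oplus>\<^bsub>?A\<^esub> y) = adj ?A x \<oplus>\<^bsub>?A\<^esub> adj ?A y"
      by (simp_all add: adds simps(4))
    have "(c \<odot>\<^bsub>?A\<^esub> x) \<otimes>\<^bsub>?A\<^esub> y = c \<odot>\<^bsub>?A\<^esub> (x \<otimes>\<^bsub>?A\<^esub> y)
        \<and> x \<otimes>\<^bsub>?A\<^esub> (c \<odot>\<^bsub>?A\<^esub> y) = c \<odot>\<^bsub>?A\<^esub> (x \<otimes>\<^bsub>?A\<^esub> y)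
        \<and> adj ?A (x \<otimes>\<^bsub>?A\<^esub> y) = adj ?A y \<otimes>\<^bsub>?A\<^esub> adj ?A x"
      using k
    proof (induction x rule: keys_subset_induct)
      case (single s e)
      show ?case using l
        by (induction y rule: keys_subset_induct)
          (use single in \<open>simp_all add: adds inve_mult algebra_simps\<close>)
    qed (simp_all add: adds)
    then show "(c \<odot>\<^bsub>?A\<^esub> x) \<otimes>\<^bsub>?A\<^esub> y = c \<odot>\<^bsub>?A\<^esub> (x \<otimes>\<^bsub>?A\<^esub> y)"
      "x \<otimes>\<^bsub>?A\<^esub> (c \<odot>\<^bsub>?A\<^esub> y) = c \<odot>\<^bsub>?A\<^esub> (x \<otimes>\<^bsub>?A\<^esub> y)"
      "adj ?A (x \<otimes>\<^bsub>?A\<^esub> y) = adj ?A y \<otimes>\<^bsub>?A\<^esub> adj ?A x" by blast+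
  qed
qed

end

lemma star_monoid_star_words: "star_monoid (star_words X) adj_word"
  by unfold_locales
    (force simp: star_words_def adj_word_def rev_map case_prod_unfold comp_def)+

lemma star_alg_free: "star_alg (free_star_algebra X)"
  unfolding free_star_algebra_def
  by (rule star_monoid.star_alg_monoid_star_algebra[OF star_monoid_star_words])

lemma free_gen_closed [simp]: "x \<in> X \<Longrightarrow> free_gen x \<in> carrier (free_star_algebra X)"
  by (simp add: free_star_algebra_def free_gen_def monoid_star_algebra_simps star_words_def)

text \<open>The working interface of a presentation: the projection is a homomorphism, it takes
  known values on generators, and it kills the relators.\<close>

lemma presented_hom:
  assumes "R \<subseteq> carrier (free_star_algebra X)"
  defines "p \<equiv> (+>\<^bsub>free_star_algebra X\<^esub>) (star_ideal_gen (free_star_algebra X) R)"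
  shows "star_alg_hom (free_star_algebra X) (presented_star_algebra X R) p"
    and "\<And>x. p (free_gen x) = presented_gen X R x"
    and "\<And>x. x \<in> R \<Longrightarrow> p x = \<zero>\<^bsub>presented_star_algebra X R\<^esub>"
  using star_alg.quot_gen_hom[OF star_alg_free assms(1)]
  by (simp_all add: p_def presented_star_algebra_def presented_gen_def)

section \<open>Tensor products\<close>

locale star_alg_pair = A: star_alg A + B: star_alg B
  for A :: "'a star_algebra" and B :: "'b star_algebra"
begin

abbreviation "T \<equiv> tensor_star_algebra A B"
abbreviation "tens \<equiv> tensor_elem A B"

lemma star_alg_pair_star_algebra: "star_alg (pair_star_algebra A B)"
proof -
  interpret Group.monoid "A \<times>\<times> B"
    by (rule DirProd_monoid) unfold_locales
  have "star_monoid (A \<times>\<times> B) (\<lambda>(x, y). (adj A x, adj B y))"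
    by unfold_locales (auto simp: DirProd_def A.adj_mult B.adj_mult)
  then show ?thesis
    unfolding pair_star_algebra_def by (rule star_monoid.star_alg_monoid_star_algebra)
qed

text \<open>The tensor relators are written with the subtraction of finitely supported functions,
  whereas passing from relators to equations uses subtraction in the ring.\<close>

lemma pair_minus:
  assumes "f \<in> carrier (pair_star_algebra A B)" "g \<in> carrier (pair_star_algebra A B)"
  shows "f \<ominus>\<^bsub>pair_star_algebra A B\<^esub> g = f - g"
proof -
  interpret F: star_alg "pair_star_algebra A B" by (rule star_alg_pair_star_algebra)
  have "- g \<in> carrier (pair_star_algebra A B)"
    using assms by (simp add: pair_star_algebra_def monoid_star_algebra_simps)
  then have "\<ominus>\<^bsub>pair_star_algebra A B\<^esub> g = - g"
    using assms by (intro F.minus_equality) (simp_all add: pair_star_algebra_def monoid_star_algebra_simps)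
  then show ?thesis
    by (simp add: F.minus_eq) (simp add: pair_star_algebra_def monoid_star_algebra_simps)
qed

lemma pair_closed:
  "x \<in> carrier A \<Longrightarrow> y \<in> carrier B \<Longrightarrow> Poly_Mapping.single (x, y) c \<in> carrier (pair_star_algebra A B)"
  by (simp add: pair_star_algebra_def monoid_star_algebra_simps)

lemma tensor_relators_closed: "tensor_relators A B \<subseteq> carrier (pair_star_algebra A B)"
proof -
  interpret F: star_alg "pair_star_algebra A B" by (rule star_alg_pair_star_algebra)
  have diff: "f - g \<in> carrier (pair_star_algebra A B)"
    if "f \<in> carrier (pair_star_algebra A B)" "g \<in> carrier (pair_star_algebra A B)" for f g
    using that F.minus_closed pair_minus by metis
  show ?thesis
    by (auto simp: tensor_relators_def Let_def intro!: diff pair_closed)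
qed

lemma tensor_hom:
  defines "p \<equiv> (+>\<^bsub>pair_star_algebra A B\<^esub>) (tensor_ideal A B)"
  shows "star_alg_hom (pair_star_algebra A B) T p"
    and "x \<in> tensor_relators A B \<Longrightarrow> p x = \<zero>\<^bsub>T\<^esub>"
  using star_alg.quot_gen_hom[OF star_alg_pair_star_algebra tensor_relators_closed]
  by (simp_all add: p_def tensor_star_algebra_def tensor_ideal_def)

lemma star_alg_tensor: "star_alg T"
  using tensor_hom(1) by (simp add: star_alg_hom_def)

lemma tens_closed:
  assumes "x \<in> carrier A" "y \<in> carrier B"
  shows "tens x y \<in> carrier T"
proof -
  interpret p: star_alg_hom "pair_star_algebra A B" T "(+>\<^bsub>pair_star_algebra A B\<^esub>) (tensor_ideal A B)"
    by (rule tensor_hom)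
  show ?thesis using assms by (simp add: tensor_elem_def pair_closed)
qed

lemma tens_mult:
  assumes "x \<in> carrier A" "x' \<in> carrier A" "y \<in> carrier B" "y' \<in> carrier B"
  shows "tens x y \<otimes>\<^bsub>T\<^esub> tens x' y' = tens (x \<otimes>\<^bsub>A\<^esub> x') (y \<otimes>\<^bsub>B\<^esub> y')"
proof -
  interpret p: star_alg_hom "pair_star_algebra A B" T "(+>\<^bsub>pair_star_algebra A B\<^esub>) (tensor_ideal A B)"
    by (rule tensor_hom)
  show ?thesis using assms
    by (simp add: tensor_elem_def pair_closed p.hom_mult[symmetric] del: p.hom_mult)
      (simp add: pair_star_algebra_def DirProd_def)
qed

lemma tens_adj:
  assumes "x \<in> carrier A" "y \<in> carrier B"
  shows "adj T (tens x y) = tens (adj A x) (adj B y)"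
proof -
  interpret p: star_alg_hom "pair_star_algebra A B" T "(+>\<^bsub>pair_star_algebra A B\<^esub>) (tensor_ideal A B)"
    by (rule tensor_hom)
  show ?thesis using assms
    by (simp add: tensor_elem_def pair_closed p.hom_adj[symmetric] del: p.hom_adj)
      (simp add: pair_star_algebra_def)
qed

lemma tens_one: "tens \<one>\<^bsub>A\<^esub> \<one>\<^bsub>B\<^esub> = \<one>\<^bsub>T\<^esub>"
proof -
  interpret p: star_alg_hom "pair_star_algebra A B" T "(+>\<^bsub>pair_star_algebra A B\<^esub>) (tensor_ideal A B)"
    by (rule tensor_hom)
  have "\<one>\<^bsub>pair_star_algebra A B\<^esub> = Poly_Mapping.single (\<one>\<^bsub>A\<^esub>, \<one>\<^bsub>B\<^esub>) 1"
    by (simp add: pair_star_algebra_def monoid_star_algebra_simps DirProd_def)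
  then show ?thesis
    using p.hom_one by (simp add: tensor_elem_def)
qed

text \<open>Each identity is one family of tensor relators, projected to zero. A coefficient
  \<open>c\<close> on a pair is a scalar multiple in the pair algebra, hence also in its
  quotient.\<close>

lemma
  assumes "x \<in> carrier A" "y \<in> carrier B"
  shows tens_add_right: "y' \<in> carrier B \<Longrightarrow> tens x (y \<oplus>\<^bsub>B\<^esub> y') = tens x y \<oplus>\<^bsub>T\<^esub> tens x y'"
    and tens_smult_left: "tens (c \<odot>\<^bsub>A\<^esub> x) y = c \<odot>\<^bsub>T\<^esub> tens x y"
    and tens_smult_right: "tens x (c \<odot>\<^bsub>B\<^esub> y) = c \<odot>\<^bsub>T\<^esub> tens x y"
proof -
  let ?F = "pair_star_algebra A B"
  let ?p = "(+>\<^bsub>?F\<^esub>) (tensor_ideal A B)"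
  interpret p: star_alg_hom ?F T ?p
    by (rule tensor_hom)
  have eq: "?p f = ?p g" if "f \<in> carrier ?F" "g \<in> carrier ?F" "f - g \<in> tensor_relators A B" for f g
    using that tensor_hom(2)[OF that(3)]
    by (intro p.hom_eq_if_minus_eq_zero) (simp_all add: pair_minus)
  have add: "f + g = f \<oplus>\<^bsub>?F\<^esub> g" for f g
    by (simp add: pair_star_algebra_def monoid_star_algebra_simps)
  have add_closed: "f + g \<in> carrier ?F" if "f \<in> carrier ?F" "g \<in> carrier ?F" for f g
    using that by (simp add: add)
  have smult: "Poly_Mapping.single (x, y) c = c \<odot>\<^bsub>?F\<^esub> Poly_Mapping.single (x, y) 1"
    by (simp add: pair_star_algebra_def)
  show "tens x (y \<oplus>\<^bsub>B\<^esub> y') = tens x y \<oplus>\<^bsub>T\<^esub> tens x y'" if "y' \<in> carrier B"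
  proof -
    have "?p (Poly_Mapping.single (x, y \<oplus>\<^bsub>B\<^esub> y') 1)
        = ?p (Poly_Mapping.single (x, y) 1 + Poly_Mapping.single (x, y') 1)"
      using assms that
      by (intro eq add_closed pair_closed) (auto simp: tensor_relators_def Let_def diff_diff_add)
    then show ?thesis using assms that by (simp add: tensor_elem_def add pair_closed)
  qed
  have "?p (Poly_Mapping.single (c \<odot>\<^bsub>A\<^esub> x, y) 1) = ?p (Poly_Mapping.single (x, y) c)"
    using assms by (intro eq) (auto simp: pair_closed tensor_relators_def Let_def)
  then show "tens (c \<odot>\<^bsub>A\<^esub> x) y = c \<odot>\<^bsub>T\<^esub> tens x y"
    using assms by (simp add: tensor_elem_def smult pair_closed)
  have "?p (Poly_Mapping.single (x, c \<odot>\<^bsub>B\<^esub> y) 1) = ?p (Poly_Mapping.single (x, y) c)"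
    using assms by (intro eq) (auto simp: pair_closed tensor_relators_def Let_def)
  then show "tens x (c \<odot>\<^bsub>B\<^esub> y) = c \<odot>\<^bsub>T\<^esub> tens x y"
    using assms by (simp add: tensor_elem_def smult pair_closed)
qed

text \<open>Through this homomorphism the isometry property of \<open>u\<close> passes to
  \<open>1 \<otimes> u\<close>.\<close>

lemma star_alg_hom_tens_one: "star_alg_hom B T (tens \<one>\<^bsub>A\<^esub>)"
proof -
  interpret T: star_alg T by (rule star_alg_tensor)
  have "ring_hom_ring B T (tens \<one>\<^bsub>A\<^esub>)"
    by (intro ring_hom_ringI B.ring_axioms T.ring_axioms)
      (simp_all add: tens_closed tens_mult tens_add_right tens_one)
  then interpret ring_hom_ring B T "tens \<one>\<^bsub>A\<^esub>" .
  show ?thesis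
    by unfold_locales (simp_all add: tens_smult_right tens_adj)
qed

lemma tens_in_tensor_subalgebra:
  "x \<in> carrier A \<Longrightarrow> y \<in> C \<Longrightarrow> tens x y \<in> tensor_subalgebra A B C"
  by (auto simp: tensor_subalgebra_def tensor_elem_def)

lemma tensor_subalgebra_closed:
  assumes "C \<subseteq> carrier B"
  shows "tensor_subalgebra A B C \<subseteq> carrier T"
proof -
  interpret p: star_alg_hom "pair_star_algebra A B" T "(+>\<^bsub>pair_star_algebra A B\<^esub>) (tensor_ideal A B)"
    by (rule tensor_hom)
  have "{f. Poly_Mapping.keys f \<subseteq> carrier A \<times> C} \<subseteq> carrier (pair_star_algebra A B)"
    using assms by (auto simp: pair_star_algebra_def monoid_star_algebra_simps)
  then show ?thesis by (auto simp: tensor_subalgebra_def)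
qed

end

section \<open>Adjoining an inverse square root\<close>

locale adjoin = T: star_alg T for T :: "'a star_algebra" +
  fixes C y
  assumes C: "C \<subseteq> carrier T" and y: "y \<in> carrier T"
begin

abbreviation "E \<equiv> adjoin_inv_sqrt T C y"
abbreviation "emb \<equiv> adjoin_emb T C y"
abbreviation "rt \<equiv> adjoin_root T C y"

lemma adjoin_relators_closed:
  "adjoin_relators T C y \<subseteq> carrier (free_star_algebra (adjoin_gens T))"
proof -
  let ?F = "free_star_algebra (adjoin_gens T)"
  interpret F: star_alg ?F by (rule star_alg_free)
  have [simp]: "free_gen (Some x) \<in> carrier ?F" if "x \<in> carrier T" for x
    using that by (simp add: adjoin_gens_def)
  have [simp]: "free_gen None \<in> carrier ?F"
    by (simp add: adjoin_gens_def)
  have [simp]: "x \<in> carrier T" if "x \<in> C" for x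
    using that C by blast
  show ?thesis using y
    by (auto simp: adjoin_relators_def Let_def)
qed

text \<open>Each claim is one family of relators of the universal extension, pushed through the
  projection from the free algebra. The families on sums, scalars, products, unit and adjoints
  together make \<open>emb\<close> a homomorphism.\<close>

lemma adjoin_emb_root:
  shows adjoin_emb_hom: "star_alg_hom T E emb"
    and root_closed: "rt \<in> carrier E"
    and adj_root: "adj E rt = rt"
    and root_commute: "x \<in> C \<Longrightarrow> rt \<otimes>\<^bsub>E\<^esub> emb x = emb x \<otimes>\<^bsub>E\<^esub> rt"
    and root_square_inverse: "(rt \<otimes>\<^bsub>E\<^esub> rt) \<otimes>\<^bsub>E\<^esub> emb y = \<one>\<^bsub>E\<^esub>"
proof -
  let ?F = "free_star_algebra (adjoin_gens T)"
  define p where "p = (+>\<^bsub>?F\<^esub>) (star_ideal_gen ?F (adjoin_relators T C y))"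
  interpret p: star_alg_hom ?F E p
    unfolding p_def adjoin_inv_sqrt_def by (rule presented_hom[OF adjoin_relators_closed])
  have emb: "emb x = p (free_gen (Some x))" for x
    unfolding p_def adjoin_emb_def by (rule presented_hom(2)[OF adjoin_relators_closed, symmetric])
  have rt: "rt = p (free_gen None)"
    unfolding p_def adjoin_root_def by (rule presented_hom(2)[OF adjoin_relators_closed, symmetric])
  have rel: "p f = p g"
    if "f \<ominus>\<^bsub>?F\<^esub> g \<in> adjoin_relators T C y" "f \<in> carrier ?F" "g \<in> carrier ?F" for f g
    using presented_hom(3)[OF adjoin_relators_closed that(1)] that(2,3)
    by (intro p.hom_eq_if_minus_eq_zero) (simp_all add: p_def adjoin_inv_sqrt_def)
  have [simp]: "free_gen (Some x) \<in> carrier ?F" if "x \<in> carrier T" for x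
    using that by (simp add: adjoin_gens_def)
  have [simp]: "free_gen None \<in> carrier ?F"
    by (simp add: adjoin_gens_def)
  have [simp]: "x \<in> carrier T" if "x \<in> C" for x
    using that C by blast
  note mem = adjoin_relators_def Let_def
  have emb_add: "emb (x \<oplus>\<^bsub>T\<^esub> x') = emb x \<oplus>\<^bsub>E\<^esub> emb x'" if "x \<in> carrier T" "x' \<in> carrier T" for x x'
  proof -
    have "p (free_gen (Some (x \<oplus>\<^bsub>T\<^esub> x'))) = p (free_gen (Some x) \<oplus>\<^bsub>?F\<^esub> free_gen (Some x'))"
      by (rule rel) (unfold mem, use that in blast, use that in simp_all)
    then show ?thesis using that by (simp add: emb)
  qed
  have emb_mult: "emb (x \<otimes>\<^bsub>T\<^esub> x') = emb x \<otimes>\<^bsub>E\<^esub> emb x'" if "x \<in> carrier T" "x' \<in> carrier T" for x x'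
  proof -
    have "p (free_gen (Some (x \<otimes>\<^bsub>T\<^esub> x'))) = p (free_gen (Some x) \<otimes>\<^bsub>?F\<^esub> free_gen (Some x'))"
      by (rule rel) (unfold mem, use that in blast, use that in simp_all)
    then show ?thesis using that by (simp add: emb)
  qed
  have emb_smult: "emb (c \<odot>\<^bsub>T\<^esub> x) = c \<odot>\<^bsub>E\<^esub> emb x" if "x \<in> carrier T" for c x
  proof -
    have "p (free_gen (Some (c \<odot>\<^bsub>T\<^esub> x))) = p (c \<odot>\<^bsub>?F\<^esub> free_gen (Some x))"
      by (rule rel) (unfold mem, use that in blast, use that in simp_all)
    then show ?thesis using that by (simp add: emb)
  qed
  have emb_adj: "emb (adj T x) = adj E (emb x)" if "x \<in> carrier T" for x
  proof -
    have "p (free_gen (Some (adj T x))) = p (adj ?F (free_gen (Some x)))"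
      by (rule rel) (unfold mem, use that in blast, use that in simp_all)
    then show ?thesis using that by (simp add: emb)
  qed
  have emb_one: "emb \<one>\<^bsub>T\<^esub> = \<one>\<^bsub>E\<^esub>"
  proof -
    have "p (free_gen (Some \<one>\<^bsub>T\<^esub>)) = p \<one>\<^bsub>?F\<^esub>"
      by (rule rel) (unfold mem, blast, simp_all)
    then show ?thesis by (simp add: emb)
  qed
  have "ring_hom_ring T E emb"
    by (intro ring_hom_ringI T.ring_axioms p.B.ring_axioms)
      (simp_all add: emb_add emb_mult emb_one, simp add: emb)
  then interpret emb: ring_hom_ring T E emb .
  show "star_alg_hom T E emb"
    by unfold_locales (simp_all add: emb_smult emb_adj)
  show "rt \<in> carrier E" by (simp add: rt)
  have "p (adj ?F (free_gen None)) = p (free_gen None)"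
    by (rule rel) (unfold mem, blast, simp_all)
  then show "adj E rt = rt" by (simp add: rt)
  show "rt \<otimes>\<^bsub>E\<^esub> emb x = emb x \<otimes>\<^bsub>E\<^esub> rt" if "x \<in> C"
  proof -
    have "p (free_gen None \<otimes>\<^bsub>?F\<^esub> free_gen (Some x)) = p (free_gen (Some x) \<otimes>\<^bsub>?F\<^esub> free_gen None)"
      by (rule rel) (unfold mem, use that in blast, use that in simp_all)
    then show ?thesis using that by (simp add: emb rt)
  qed
  have "p ((free_gen None \<otimes>\<^bsub>?F\<^esub> free_gen None) \<otimes>\<^bsub>?F\<^esub> free_gen (Some y)) = p \<one>\<^bsub>?F\<^esub>"
    by (rule rel) (unfold mem, blast, use y in simp_all)
  then show "(rt \<otimes>\<^bsub>E\<^esub> rt) \<otimes>\<^bsub>E\<^esub> emb y = \<one>\<^bsub>E\<^esub>"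
    using y by (simp add: emb rt)
qed

end

section \<open>Matrices and isometries\<close>

lemma (in abelian_monoid) finsum_swap:
  assumes "finite S" "finite R" "\<And>i j. i \<in> S \<Longrightarrow> j \<in> R \<Longrightarrow> f i j \<in> carrier G"
  shows "(\<Oplus>i\<in>S. \<Oplus>j\<in>R. f i j) = (\<Oplus>j\<in>R. \<Oplus>i\<in>S. f i j)"
  using assms(1,3)
proof (induction S)
  case (insert x S)
  then have "(\<Oplus>j\<in>R. \<Oplus>i\<in>insert x S. f i j) = (\<Oplus>j\<in>R. f x j \<oplus> (\<Oplus>i\<in>S. f i j))"
    by (intro finsum_cong') (auto intro!: finsum_closed finsum_insert)
  also have "\<dots> = (\<Oplus>j\<in>R. f x j) \<oplus> (\<Oplus>j\<in>R. \<Oplus>i\<in>S. f i j)"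
    using insert by (intro finsum_addf) (auto intro!: finsum_closed)
  also have "\<dots> = (\<Oplus>i\<in>insert x S. \<Oplus>j\<in>R. f i j)"
    using insert by (subst finsum_insert) (auto intro!: finsum_closed)
  finally show ?case ..
qed (simp add: finsum_zero)

text \<open>\<open>finsum\<close> depends on the whole record including its carrier, so a sum over
  the restricted record is a different term even when its value is the same. This lets computations
  in the ambient algebra be restated over a subalgebra.\<close>

lemma (in ring) finsum_subring:
  assumes B: "subring B R" and S: "finite S" "f \<in> S \<rightarrow> B"
  shows "finsum (R\<lparr>carrier := B\<rparr>) f S = finsum R f S" "finsum R f S \<in> B"
proof -
  interpret B: ring "R\<lparr>carrier := B\<rparr>" using B by (rule subring_is_ring)
  have [simp]: "x \<in> carrier R" if "x \<in> B" for x
    using subringE(1)[OF B] that by blast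
  show *: "finsum (R\<lparr>carrier := B\<rparr>) f S = finsum R f S"
    using S
  proof (induction S)
    case (insert x S)
    then have "finsum (R\<lparr>carrier := B\<rparr>) f (insert x S) = f x \<oplus> finsum (R\<lparr>carrier := B\<rparr>) f S"
      by (subst B.finsum_insert) auto
    with insert show ?case by (subst finsum_insert) (auto simp: Pi_iff)
  qed simp
  show "finsum R f S \<in> B"
    using S B.finsum_closed[of f S] by (simp add: * Pi_iff)
qed

context star_alg
begin

lemma smult_zero [simp]: "c \<odot> \<zero> = \<zero>"
  by (metis add.l_cancel_one l_zero smult_add smult_closed zero_closed)

lemma smult_finsum:
  assumes "finite S" "f \<in> S \<rightarrow> carrier A"
  shows "c \<odot> finsum A f S = (\<Oplus>i\<in>S. c \<odot> f i)"
  using assms by (induction S) (auto simp: finsum_insert smult_add Pi_iff)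

lemma finsum_mult_finsum:
  assumes "finite S" "finite R" "\<And>i. i \<in> S \<Longrightarrow> f i \<in> carrier A" "\<And>j. j \<in> R \<Longrightarrow> g j \<in> carrier A"
  shows "(\<Oplus>i\<in>S. f i) \<otimes> (\<Oplus>j\<in>R. g j) = (\<Oplus>i\<in>S. \<Oplus>j\<in>R. f i \<otimes> g j)"
proof -
  have "(\<Oplus>i\<in>S. f i) \<otimes> (\<Oplus>j\<in>R. g j) = (\<Oplus>i\<in>S. f i \<otimes> (\<Oplus>j\<in>R. g j))"
    using assms by (intro finsum_ldistr) (auto intro!: finsum_closed)
  also have "\<dots> = (\<Oplus>i\<in>S. \<Oplus>j\<in>R. f i \<otimes> g j)"
    using assms by (intro finsum_cong') (auto intro!: finsum_rdistr finsum_closed)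
  finally show ?thesis .
qed

lemma matr_mult_closed:
  assumes "\<And>k. k \<in> {1..m} \<Longrightarrow> L i k \<in> carrier A" "\<And>k. k \<in> {1..m} \<Longrightarrow> M k j \<in> carrier A"
  shows "matr_mult m A L M i j \<in> carrier A"
  using assms by (auto simp: matr_mult_def intro!: finsum_closed)

lemma matr_mult_cong:
  assumes "\<And>k. k \<in> {1..m} \<Longrightarrow> L i k = L' i k" "\<And>k. k \<in> {1..m} \<Longrightarrow> M k j = M' k j"
    and "\<And>k. k \<in> {1..m} \<Longrightarrow> L' i k \<in> carrier A" "\<And>k. k \<in> {1..m} \<Longrightarrow> M' k j \<in> carrier A"
  shows "matr_mult m A L M i j = matr_mult m A L' M' i j"
  unfolding matr_mult_def using assms by (intro finsum_cong') auto

text \<open>Stated entry by entry and for rectangular shapes: the isometries are 4 by 2, and values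
  outside the index ranges are arbitrary, so matrices cannot be compared as functions.\<close>

lemma matr_mult_assoc:
  assumes L: "\<And>k. k \<in> {1..m} \<Longrightarrow> L i k \<in> carrier A"
    and M: "\<And>k l. k \<in> {1..m} \<Longrightarrow> l \<in> {1..n} \<Longrightarrow> M k l \<in> carrier A"
    and N: "\<And>l. l \<in> {1..n} \<Longrightarrow> N l j \<in> carrier A"
  shows "matr_mult n A (matr_mult m A L M) N i j = matr_mult m A L (matr_mult n A M N) i j"
proof -
  have "matr_mult n A (matr_mult m A L M) N i j = (\<Oplus>l\<in>{1..n}. \<Oplus>k\<in>{1..m}. L i k \<otimes> M k l \<otimes> N l j)"
    unfolding matr_mult_def using assms
    by (intro finsum_cong') (auto intro!: finsum_closed finsum_ldistr)
  also have "\<dots> = (\<Oplus>k\<in>{1..m}. \<Oplus>l\<in>{1..n}. L i k \<otimes> M k l \<otimes> N l j)"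
    using assms by (intro finsum_swap) auto
  also have "\<dots> = (\<Oplus>k\<in>{1..m}. \<Oplus>l\<in>{1..n}. L i k \<otimes> (M k l \<otimes> N l j))"
    using assms by (intro finsum_cong') (auto simp: m_assoc intro!: finsum_closed finsum_cong')
  also have "\<dots> = matr_mult m A L (matr_mult n A M N) i j"
    unfolding matr_mult_def using assms
    by (intro finsum_cong') (auto intro!: finsum_closed finsum_rdistr[symmetric])
  finally show ?thesis .
qed

lemma adj_matr_mult_adj:
  assumes "\<And>a. a \<in> {1..m} \<Longrightarrow> Y i a \<in> carrier A" "\<And>a. a \<in> {1..m} \<Longrightarrow> Z j a \<in> carrier A"
  shows "adj A (matr_mult m A Y (matr_adj A Z) i j) = matr_mult m A Z (matr_adj A Y) j i"
proof -
  have "adj A (matr_mult m A Y (matr_adj A Z) i j) = (\<Oplus>a\<in>{1..m}. adj A (Y i a \<otimes> adj A (Z j a)))"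
    unfolding matr_mult_def matr_adj_def using assms by (intro adj_finsum) auto
  also have "\<dots> = matr_mult m A Z (matr_adj A Y) j i"
    unfolding matr_mult_def matr_adj_def using assms
    by (intro finsum_cong') (auto simp: adj_mult)
  finally show ?thesis .
qed

text \<open>Reassociation brings \<open>U* U = 1\<close> into the middle of \<open>X U* U Y\<close>.
  This one cancellation gives \<open>V V* = W W*\<close>, \<open>V* V = U U*\<close> and the
  idempotence of both range projections.\<close>

lemma isometry_cancel:
  assumes X: "\<And>a. a \<in> {1..m} \<Longrightarrow> X i a \<in> carrier A"
    and Y: "\<And>a. a \<in> {1..m} \<Longrightarrow> Y a j \<in> carrier A"
    and U: "\<And>k a. k \<in> {1..n} \<Longrightarrow> a \<in> {1..m} \<Longrightarrow> U k a \<in> carrier A"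
    and isometry: "\<And>a b. a \<in> {1..m} \<Longrightarrow> b \<in> {1..m} \<Longrightarrow>
      matr_mult n A (matr_adj A U) U a b = (if a = b then \<one> else \<zero>)"
  shows "matr_mult n A (matr_mult m A X (matr_adj A U)) (matr_mult m A U Y) i j = matr_mult m A X Y i j"
proof -
  have U': "matr_adj A U a k \<in> carrier A" if "k \<in> {1..n}" "a \<in> {1..m}" for k a
    using U that by (simp add: matr_adj_def)
  have "matr_mult n A (matr_adj A U) (matr_mult m A U Y) a j = Y a j" if a: "a \<in> {1..m}" for a
  proof -
    have "matr_mult n A (matr_adj A U) (matr_mult m A U Y) a j
        = matr_mult m A (matr_mult n A (matr_adj A U) U) Y a j"
      using U U' Y a by (intro matr_mult_assoc[symmetric]) auto
    also have "\<dots> = (\<Oplus>b\<in>{1..m}. if a = b then Y b j else \<zero>)"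
      unfolding matr_mult_def[of m] using isometry a Y by (intro finsum_cong') auto
    also have "\<dots> = Y a j"
      using a Y by (intro finsum_singleton) auto
    finally show ?thesis .
  qed
  then have "matr_mult m A X (matr_mult n A (matr_adj A U) (matr_mult m A U Y)) i j = matr_mult m A X Y i j"
    using X Y by (intro matr_mult_cong) auto
  moreover have "matr_mult n A (matr_mult m A X (matr_adj A U)) (matr_mult m A U Y) i j
      = matr_mult m A X (matr_mult n A (matr_adj A U) (matr_mult m A U Y)) i j"
    using X U' U Y by (intro matr_mult_assoc matr_mult_closed) auto
  ultimately show ?thesis by simp
qed

lemma matr_mult_subalgebra:
  assumes B: "star_subalgebra B A"
    and "\<And>k. k \<in> {1..m} \<Longrightarrow> L i k \<in> B" "\<And>k. k \<in> {1..m} \<Longrightarrow> M k j \<in> B"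
  shows "matr_mult m (A\<lparr>carrier := B\<rparr>) L M i j = matr_mult m A L M i j"
    and "matr_mult m A L M i j \<in> B"
proof -
  have subring: "subring B A" using B by (simp add: star_subalgebra_def)
  have "(\<lambda>k. L i k \<otimes> M k j) \<in> {1..m} \<rightarrow> B"
    using assms(2,3) subringE(6)[OF subring] by auto
  from finsum_subring[OF subring _ this]
  show "matr_mult m (A\<lparr>carrier := B\<rparr>) L M i j = matr_mult m A L M i j"
    and "matr_mult m A L M i j \<in> B"
    by (simp_all add: matr_mult_def)
qed

text \<open>With \<open>V = W U*\<close> one has \<open>V V* = W U* U W* = P\<close> and
  \<open>V* V = U W* W U* = Q\<close>. The isometries live over the large algebra \<open>A\<close>,
  and the conclusion is drawn over \<open>B\<close> because the entries of \<open>V\<close> are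
  there.\<close>

lemma murray_von_neumann_equiv_isometries:
  assumes B: "star_subalgebra B A"
    and W: "\<And>i a. i \<in> {1..n} \<Longrightarrow> a \<in> {1..m} \<Longrightarrow> W i a \<in> carrier A"
    and U: "\<And>i a. i \<in> {1..n} \<Longrightarrow> a \<in> {1..m} \<Longrightarrow> U i a \<in> carrier A"
    and WW: "\<And>a b. a \<in> {1..m} \<Longrightarrow> b \<in> {1..m} \<Longrightarrow>
      matr_mult n A (matr_adj A W) W a b = (if a = b then \<one> else \<zero>)"
    and UU: "\<And>a b. a \<in> {1..m} \<Longrightarrow> b \<in> {1..m} \<Longrightarrow>
      matr_mult n A (matr_adj A U) U a b = (if a = b then \<one> else \<zero>)"
    and V: "\<And>i j. i \<in> {1..n} \<Longrightarrow> j \<in> {1..n} \<Longrightarrow> matr_mult m A W (matr_adj A U) i j \<in> B"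
    and P: "\<And>i j. i \<in> {1..n} \<Longrightarrow> j \<in> {1..n} \<Longrightarrow> P i j = matr_mult m A W (matr_adj A W) i j"
    and Q: "\<And>i j. i \<in> {1..n} \<Longrightarrow> j \<in> {1..n} \<Longrightarrow> Q i j = matr_mult m A U (matr_adj A U) i j"
  shows "murray_von_neumann_equiv n (A\<lparr>carrier := B\<rparr>) P Q"
proof -
  let ?B = "A\<lparr>carrier := B\<rparr>"
  define V where "V = matr_mult m A W (matr_adj A U)"
  have VB: "V i j \<in> B" if "i \<in> {1..n}" "j \<in> {1..n}" for i j
    using V that by (simp add: V_def)
  have adjB: "adj A x \<in> B" if "x \<in> B" for x
    using B that by (simp add: star_subalgebra_def)
  have [simp]: "matr_adj ?B M = matr_adj A M" for M by (simp add: matr_adj_def fun_eq_iff)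
  have adj_adj_matr: "matr_adj A (matr_adj A M) i j = M i j" if "M i j \<in> carrier A" for M i j
    using that by (simp add: matr_adj_def)
  have closed: "matr_adj A M a i \<in> carrier A" if "M i a \<in> carrier A" for M i a
    using that by (simp add: matr_adj_def)
  \<comment> \<open>Both projections come from this claim: \<open>P\<close> with
    \<open>X = V\<close>, \<open>Y = W\<close>, \<open>Z = U\<close>, and \<open>Q\<close> with
    \<open>X = V*\<close> and the roles of \<open>W\<close> and \<open>U\<close> exchanged.\<close>
  have projection: "projection_over n ?B R \<and> (\<forall>i\<in>{1..n}. \<forall>j\<in>{1..n}. R i j = matr_mult n A X (matr_adj A X) i j)"
    if X: "\<And>i j. i \<in> {1..n} \<Longrightarrow> j \<in> {1..n} \<Longrightarrow> X i j \<in> B"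
      and Y: "\<And>i a. i \<in> {1..n} \<Longrightarrow> a \<in> {1..m} \<Longrightarrow> Y i a \<in> carrier A"
      and Z: "\<And>i a. i \<in> {1..n} \<Longrightarrow> a \<in> {1..m} \<Longrightarrow> Z i a \<in> carrier A"
      and YY: "\<And>a b. a \<in> {1..m} \<Longrightarrow> b \<in> {1..m} \<Longrightarrow>
        matr_mult n A (matr_adj A Y) Y a b = (if a = b then \<one> else \<zero>)"
      and ZZ: "\<And>a b. a \<in> {1..m} \<Longrightarrow> b \<in> {1..m} \<Longrightarrow>
        matr_mult n A (matr_adj A Z) Z a b = (if a = b then \<one> else \<zero>)"
      and XYZ: "\<And>i j. i \<in> {1..n} \<Longrightarrow> j \<in> {1..n} \<Longrightarrow> X i j = matr_mult m A Y (matr_adj A Z) i j"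
      and R: "\<And>i j. i \<in> {1..n} \<Longrightarrow> j \<in> {1..n} \<Longrightarrow> R i j = matr_mult m A Y (matr_adj A Y) i j"
    for X Y Z R
  proof -
    have XX: "R i j = matr_mult n A X (matr_adj A X) i j" if ij: "i \<in> {1..n}" "j \<in> {1..n}" for i j
    proof -
      have "matr_adj A X k j = matr_mult m A Z (matr_adj A Y) k j" if "k \<in> {1..n}" for k
        unfolding matr_adj_def[of A X] XYZ[OF ij(2) that]
        using that ij Y Z by (intro adj_matr_mult_adj) auto
      then have "matr_mult n A X (matr_adj A X) i j
        = matr_mult n A (matr_mult m A Y (matr_adj A Z)) (matr_mult m A Z (matr_adj A Y)) i j"
        using ij XYZ Y Z by (intro matr_mult_cong matr_mult_closed) (auto simp: closed)
      also have "\<dots> = matr_mult m A Y (matr_adj A Y) i j"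
        using ij Y Z ZZ by (intro isometry_cancel) (auto simp: closed)
      finally show ?thesis using R ij by simp
    qed
    \<comment> \<open>The entries of \<open>Y\<close> may lie outside \<open>B\<close>, so
      membership is read off from \<open>X X*\<close> rather than from \<open>Y Y*\<close>.\<close>
    have RB: "R i j \<in> B" if "i \<in> {1..n}" "j \<in> {1..n}" for i j
      unfolding XX[OF that] using that X
      by (intro matr_mult_subalgebra[OF B]) (auto simp: matr_adj_def adjB)
    have "R i j = matr_mult n ?B R R i j" if ij: "i \<in> {1..n}" "j \<in> {1..n}" for i j
    proof -
      have "matr_mult n ?B R R i j = matr_mult n A R R i j"
        using ij RB by (intro matr_mult_subalgebra[OF B]) auto
      also have "\<dots> = matr_mult n A (matr_mult m A Y (matr_adj A Y)) (matr_mult m A Y (matr_adj A Y)) i j"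
        using ij R Y by (intro matr_mult_cong matr_mult_closed) (auto simp: closed)
      also have "\<dots> = R i j"
        unfolding R[OF ij] using ij Y YY by (intro isometry_cancel) (auto simp: closed)
      finally show ?thesis ..
    qed
    moreover have "matr_adj A R i j = R i j" if ij: "i \<in> {1..n}" "j \<in> {1..n}" for i j
      unfolding matr_adj_def[of A R] R[OF ij] R[OF ij(2,1)]
      using ij Y by (intro adj_matr_mult_adj) auto
    ultimately show ?thesis
      using RB XX by (auto simp: projection_over_def matr_carrier_def matr_eq_def)
  qed
  have P': "projection_over n ?B P" "\<forall>i\<in>{1..n}. \<forall>j\<in>{1..n}. P i j = matr_mult n A V (matr_adj A V) i j"
    using projection[of V W U P] VB W U WW UU P by (auto simp: V_def)
  have adjV: "matr_adj A V i j = matr_mult m A U (matr_adj A W) i j" if ij: "i \<in> {1..n}" "j \<in> {1..n}" for i j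
    unfolding V_def matr_adj_def[of A "matr_mult m A W (matr_adj A U)"]
    using ij U W by (intro adj_matr_mult_adj) auto
  have V'B: "matr_adj A V i j \<in> B" if "i \<in> {1..n}" "j \<in> {1..n}" for i j
    using VB that by (simp add: matr_adj_def adjB)
  \<comment> \<open>The claim delivers \<open>V* V**\<close>. The double adjoint is then replaced by
    \<open>V\<close> under the sum, which is legitimate at indices where the entries of
    \<open>V\<close> lie in the carrier.\<close>
  have "projection_over n ?B Q \<and>
    (\<forall>i\<in>{1..n}. \<forall>j\<in>{1..n}. Q i j = matr_mult n A (matr_adj A V) (matr_adj A (matr_adj A V)) i j)"
    using V'B adjV U W UU WW Q by (intro projection[of "matr_adj A V" U W Q]) auto
  then have Q': "projection_over n ?B Q" "\<forall>i\<in>{1..n}. \<forall>j\<in>{1..n}. Q i j = matr_mult n A (matr_adj A V) V i j"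
  proof -
    assume *: "projection_over n ?B Q \<and>
      (\<forall>i\<in>{1..n}. \<forall>j\<in>{1..n}. Q i j = matr_mult n A (matr_adj A V) (matr_adj A (matr_adj A V)) i j)"
    then show "projection_over n ?B Q" by blast
    have Vc: "V i j \<in> carrier A" if "i \<in> {1..n}" "j \<in> {1..n}" for i j
      using W U that unfolding V_def by (intro matr_mult_closed) (auto simp: closed)
    have "matr_mult n A (matr_adj A V) (matr_adj A (matr_adj A V)) i j = matr_mult n A (matr_adj A V) V i j"
      if "i \<in> {1..n}" "j \<in> {1..n}" for i j
      using that Vc by (intro matr_mult_cong) (auto simp: adj_adj_matr closed)
    then show "\<forall>i\<in>{1..n}. \<forall>j\<in>{1..n}. Q i j = matr_mult n A (matr_adj A V) V i j"
      using * by simp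
  qed
  have "matr_mult n ?B V (matr_adj A V) i j = matr_mult n A V (matr_adj A V) i j"
    "matr_mult n ?B (matr_adj A V) V i j = matr_mult n A (matr_adj A V) V i j"
    if "i \<in> {1..n}" "j \<in> {1..n}" for i j
    using that VB V'B by (auto intro!: matr_mult_subalgebra(1)[OF B])
  then have "V \<in> matr_carrier n ?B \<and> matr_eq n P (matr_mult n ?B V (matr_adj ?B V)) \<and>
      matr_eq n Q (matr_mult n ?B (matr_adj ?B V) V)"
    using P'(2) Q'(2) VB by (simp add: matr_eq_def matr_carrier_def)
  then show ?thesis
    using P'(1) Q'(1) unfolding murray_von_neumann_equiv_def by blast
qed

end

section \<open>Matrices of quaternions with braided entries\<close>

text \<open>Keeps the simplifier from turning the index 1 into \<open>Suc 0\<close>, where the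
  equations for \<open>u 1 a\<close> and the like would no longer match.\<close>

declare One_nat_def [simp del]

lemma mu_cnj: "mu \<theta> * cnj (mu \<theta>) = 1" "cnj (mu \<theta>) * mu \<theta> = 1"
proof -
  have "mu \<theta> = cis (pi * \<theta>)"
    by (simp add: mu_def cis_conv_exp mult_ac)
  then show "mu \<theta> * cnj (mu \<theta>) = 1" "cnj (mu \<theta>) * mu \<theta> = 1"
    by (simp_all add: cis_cnj cis_mult)
qed

lemma atLeast1_4_cases: "(i::nat) \<in> {1..4} \<Longrightarrow> i = 1 \<or> i = 2 \<or> i = 3 \<or> i = 4"
  by auto

text \<open>Transposed entries of \<open>eta\<close> are conjugate, and all are of modulus 1 because
  \<theta> is real. This is the cancellation of phases in the product of \<open>A\<close> and
  \<open>u\<close>.\<close>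

lemma eta_mult: "i \<in> {1..4} \<Longrightarrow> j \<in> {1..4} \<Longrightarrow> eta \<theta> i j * eta \<theta> j i = 1"
  by (drule atLeast1_4_cases)+ (elim disjE; simp add: eta_def from_rows_def mu_cnj)

text \<open>Phase 1 inside the row pairs 1, 2 and 3, 4 makes entries of the two rows of a pair
  commute. In a quaternionic matrix this says that the generators of a block commute with their own
  and each other's adjoints.\<close>

lemma eta_diagonal_block:
  "eta \<theta> 1 1 = 1" "eta \<theta> 1 2 = 1" "eta \<theta> 2 1 = 1" "eta \<theta> 2 2 = 1"
  "eta \<theta> 3 3 = 1" "eta \<theta> 3 4 = 1" "eta \<theta> 4 3 = 1" "eta \<theta> 4 4 = 1"
  by (simp_all add: eta_def from_rows_def)

lemma (in abelian_monoid) finsum_1_2: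
  assumes "f \<in> {1..2} \<rightarrow> carrier G"
  shows "finsum G f {1..2::nat} = f 1 \<oplus> f 2"
proof -
  have "{1..2} = {1, 2::nat}" by auto
  then show ?thesis using assms by (simp add: Pi_iff)
qed

lemma (in abelian_monoid) finsum_1_4:
  assumes "f \<in> {1..4} \<rightarrow> carrier G"
  shows "finsum G f {1..4::nat} = f 1 \<oplus> (f 2 \<oplus> (f 3 \<oplus> f 4))"
proof -
  have "{1..4} = {1, 2, 3, 4::nat}" by auto
  then show ?thesis using assms by (simp add: Pi_iff)
qed

text \<open>The block \<open>(u i j, u i (j + 1); u (i + 1) j, u (i + 1) (j + 1))\<close> with \<open>i\<close>, \<open>j\<close> odd is the
  usual representation \<open>(z, w; - w*, z*)\<close> of a quaternion.\<close>

definition quaternionic :: "'a star_algebra \<Rightarrow> nat \<Rightarrow> 'a matr \<Rightarrow> bool" where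
  "quaternionic S n u \<longleftrightarrow> (\<forall>i\<in>{1..4}. \<forall>j\<in>{1..n}. u i j \<in> carrier S) \<and>
     (\<forall>i\<in>{1, 3}. \<forall>j\<in>{1, 3}. j < n \<longrightarrow>
        u (i + 1) j = \<ominus>\<^bsub>S\<^esub> adj S (u i (j + 1)) \<and> u (i + 1) (j + 1) = adj S (u i j))"

lemma quaternionic_closed:
  "quaternionic S n u \<Longrightarrow> i \<in> {1..4} \<Longrightarrow> j \<in> {1..n} \<Longrightarrow> u i j \<in> carrier S"
  by (simp add: quaternionic_def)

lemma (in star_alg) quaternionic_group_matr:
  assumes "\<And>x. g x \<in> carrier A"
  shows "quaternionic A 4 (group_matr A g)"
  unfolding quaternionic_def
  by (intro conjI ballI; (drule atLeast1_4_cases)?; (drule atLeast1_4_cases)?)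
    (use assms in \<open>auto simp: group_matr_def from_rows_def Let_def\<close>)

lemma (in star_alg) quaternionic_sphere_matr:
  assumes g: "\<And>x. g x \<in> carrier A"
  shows "quaternionic A 2 (sphere_matr A g)"
  unfolding quaternionic_def
proof (intro conjI ballI)
  fix i j :: nat assume "i \<in> {1..4}" "j \<in> {1..2}"
  moreover from this have "j = 1 \<or> j = 2" by auto
  ultimately show "sphere_matr A g i j \<in> carrier A"
    using g atLeast1_4_cases[of i] by (elim disjE) (auto simp: sphere_matr_def from_rows_def Let_def)
qed (use g in \<open>auto simp: sphere_matr_def from_rows_def Let_def\<close>)

context star_alg_hom
begin

text \<open>The matrix is the same expression in generators, signs and adjoints over every
  star-algebra, so the projection from a free algebra takes the matrix of free generators to that of
  the presented ones.\<close>

lemma hom_group_matr: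
  assumes "\<And>x. g x \<in> carrier A" "i \<in> {1..4}" "j \<in> {1..4}"
  shows "h (group_matr A g i j) = group_matr B (\<lambda>x. h (g x)) i j"
  using assms(2,3)[THEN atLeast1_4_cases] assms(1)
  by (elim disjE) (simp_all add: group_matr_def from_rows_def Let_def)

lemma hom_sphere_matr:
  assumes "\<And>x. g x \<in> carrier A" "i \<in> {1..4}" "j \<in> {1..2}"
  shows "h (sphere_matr A g i j) = sphere_matr B (\<lambda>x. h (g x)) i j"
proof -
  have "j = 1 \<or> j = 2" using assms(3) by auto
  then show ?thesis
    using assms(2)[THEN atLeast1_4_cases] assms(1)
    by (elim disjE) (simp_all add: sphere_matr_def from_rows_def Let_def)
qed

lemma hom_quaternionic:
  assumes "quaternionic A n u"
  shows "quaternionic B n (\<lambda>i j. h (u i j))"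
  using assms unfolding quaternionic_def by (auto simp: Ball_def)

end

text \<open>The relations of \<open>S7_alg\<close> without the normalisation \<open>u* u = 1\<close>.\<close>

definition sphere_like :: "real \<Rightarrow> 'a star_algebra \<Rightarrow> 'a matr \<Rightarrow> bool" where
  "sphere_like \<theta> S u \<longleftrightarrow> quaternionic S 2 u \<and>
     (\<forall>i\<in>{1..4}. \<forall>j\<in>{1..4}. \<forall>a\<in>{1..2}. \<forall>b\<in>{1..2}.
        u i a \<otimes>\<^bsub>S\<^esub> u j b = eta \<theta> j i \<odot>\<^bsub>S\<^esub> (u j b \<otimes>\<^bsub>S\<^esub> u i a))"

text \<open>The defining relations of \<open>M_alg\<close> as a property of a matrix, so that they
  can be transported to the quotient \<open>SL_alg\<close>.\<close>

definition group_like :: "real \<Rightarrow> 'a star_algebra \<Rightarrow> 'a matr \<Rightarrow> bool" where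
  "group_like \<theta> S a \<longleftrightarrow> quaternionic S 4 a \<and>
     (\<forall>i\<in>{1..4}. \<forall>j\<in>{1..4}. \<forall>k\<in>{1..4}. \<forall>l\<in>{1..4}.
        a i j \<otimes>\<^bsub>S\<^esub> a k l = (eta \<theta> k i * eta \<theta> j l) \<odot>\<^bsub>S\<^esub> (a k l \<otimes>\<^bsub>S\<^esub> a i j))"

lemma (in star_alg_hom) hom_group_like:
  assumes "group_like \<theta> A a"
  shows "group_like \<theta> B (\<lambda>i j. h (a i j))"
proof -
  have q: "quaternionic A 4 a"
    and comm: "\<And>i j k l. i \<in> {1..4} \<Longrightarrow> j \<in> {1..4} \<Longrightarrow> k \<in> {1..4} \<Longrightarrow> l \<in> {1..4} \<Longrightarrow>
      a i j \<otimes>\<^bsub>A\<^esub> a k l = (eta \<theta> k i * eta \<theta> j l) \<odot>\<^bsub>A\<^esub> (a k l \<otimes>\<^bsub>A\<^esub> a i j)"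
    using assms unfolding group_like_def by blast+
  have "h (a i j) \<otimes>\<^bsub>B\<^esub> h (a k l) = (eta \<theta> k i * eta \<theta> j l) \<odot>\<^bsub>B\<^esub> (h (a k l) \<otimes>\<^bsub>B\<^esub> h (a i j))"
    if "i \<in> {1..4}" "j \<in> {1..4}" "k \<in> {1..4}" "l \<in> {1..4}" for i j k l
    using arg_cong[OF comm[OF that], of h] quaternionic_closed[OF q] that by simp
  then show ?thesis
    using hom_quaternionic[OF q] unfolding group_like_def by blast
qed

section \<open>Orthogonality and equal norms of the columns\<close>

context star_alg
begin

text \<open>Each pair of rows contributes separately. With first row \<open>z1, z2\<close> it adds
  \<open>adj z1 z2 - z2 adj z1\<close> to the entry in position 1, 2, which vanishes as the factors
  commute. To the two diagonal entries it adds \<open>adj z1 z1 + z2 adj z2\<close> and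
  \<open>adj z2 z2 + z1 adj z1\<close>, which agree for the same reason. The rows 3 and 4 behave
  alike.\<close>

lemma sphere_like_gram:
  assumes u: "sphere_like \<theta> A u" and ab: "a \<in> {1..2}" "b \<in> {1..2}"
  shows "matr_mult 4 A (matr_adj A u) u a b
    = (if a = b then \<Oplus>k\<in>{1..4}. adj A (u k 1) \<otimes> u k 1 else \<zero>)"
proof -
  have q: "quaternionic A 2 u"
    and comm: "\<And>i j a b. i \<in> {1..4} \<Longrightarrow> j \<in> {1..4} \<Longrightarrow> a \<in> {1..2} \<Longrightarrow> b \<in> {1..2} \<Longrightarrow>
        u i a \<otimes> u j b = eta \<theta> j i \<odot> (u j b \<otimes> u i a)"
    using u unfolding sphere_like_def by blast+
  define z1 z2 z3 z4 where "z1 = u 1 1" "z2 = u 1 2" "z3 = u 3 1" "z4 = u 3 2"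
  note z = z1_z2_z3_z4_def
  have z_closed [simp]: "z1 \<in> carrier A" "z2 \<in> carrier A" "z3 \<in> carrier A" "z4 \<in> carrier A"
    unfolding z by (rule quaternionic_closed[OF q]; simp)+
  have u_simps: "u 1 1 = z1" "u 1 2 = z2" "u 3 1 = z3" "u 3 2 = z4"
    "u 2 1 = \<ominus> adj A z2" "u 2 2 = adj A z1" "u 4 1 = \<ominus> adj A z4" "u 4 2 = adj A z3"
    unfolding z using q unfolding quaternionic_def by (simp_all add: numeral_eq_Suc)
  have comm12: "u 1 a \<otimes> u 2 b = u 2 b \<otimes> u 1 a" if "a \<in> {1..2}" "b \<in> {1..2}" for a b
    using comm[of 1 2 a b] that quaternionic_closed[OF q] by (simp add: eta_diagonal_block)
  have comm34: "u 3 a \<otimes> u 4 b = u 4 b \<otimes> u 3 a" if "a \<in> {1..2}" "b \<in> {1..2}" for a b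
    using comm[of 3 4 a b] that quaternionic_closed[OF q] by (simp add: eta_diagonal_block)
  have uminus_inject: "\<ominus> x = \<ominus> y \<longleftrightarrow> x = y" if "x \<in> carrier A" "y \<in> carrier A" for x y
    using that by (metis minus_minus)
  have z_comm: "z1 \<otimes> adj A z2 = adj A z2 \<otimes> z1" "z1 \<otimes> adj A z1 = adj A z1 \<otimes> z1"
    "z2 \<otimes> adj A z2 = adj A z2 \<otimes> z2" "z2 \<otimes> adj A z1 = adj A z1 \<otimes> z2"
    "z3 \<otimes> adj A z4 = adj A z4 \<otimes> z3" "z3 \<otimes> adj A z3 = adj A z3 \<otimes> z3"
    "z4 \<otimes> adj A z4 = adj A z4 \<otimes> z4" "z4 \<otimes> adj A z3 = adj A z3 \<otimes> z4"
    using comm12[of 1 1] comm12[of 1 2] comm12[of 2 1] comm12[of 2 2]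
      comm34[of 1 1] comm34[of 1 2] comm34[of 2 1] comm34[of 2 2]
    by (simp_all add: u_simps l_minus r_minus uminus_inject)
  have gram: "matr_mult 4 A (matr_adj A u) u a b = adj A (u 1 a) \<otimes> u 1 b \<oplus> (adj A (u 2 a) \<otimes> u 2 b
      \<oplus> (adj A (u 3 a) \<otimes> u 3 b \<oplus> adj A (u 4 a) \<otimes> u 4 b))" if "a \<in> {1..2}" "b \<in> {1..2}" for a b
    unfolding matr_mult_def matr_adj_def using quaternionic_closed[OF q] that
    by (subst finsum_1_4) auto
  have norm: "(\<Oplus>k\<in>{1..4}. adj A (u k 1) \<otimes> u k 1) = matr_mult 4 A (matr_adj A u) u 1 1"
    by (simp add: matr_mult_def matr_adj_def)
  consider "a = 1" "b = 1" | "a = 1" "b = 2" | "a = 2" "b = 1" | "a = 2" "b = 2"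
    using ab by force
  then show ?thesis
  proof cases
    case 2
    then show ?thesis
      by (simp add: gram u_simps adj_uminus l_minus r_minus z_comm[symmetric])
        (simp add: a_assoc[symmetric] r_neg)
  next
    case 3
    then show ?thesis
      by (simp add: gram u_simps adj_uminus l_minus r_minus z_comm)
        (simp add: a_assoc[symmetric] r_neg)
  next
    case 4
    then show ?thesis
      by (simp add: norm gram u_simps adj_uminus l_minus r_minus z_comm)
        (simp add: a_ac)
  qed (simp add: norm)
qed

end

text \<open>Signs cross the tensor sign as the scalar -1, since the tensor relators speak of sums
  and scalars.\<close>

lemma (in star_alg) minus_one_smult:
  assumes x: "x \<in> carrier A"
  shows "(-1) \<odot> x = \<ominus> x"
proof -
  have "0 \<odot> x \<oplus> 0 \<odot> x = 0 \<odot> x"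
    using add_smult[OF x, of 0 0] by simp
  then have "0 \<odot> x = \<zero>" using x by (metis add.l_cancel_one smult_closed)
  then have "(-1) \<odot> x \<oplus> x = \<zero>"
    using add_smult[OF x, of "-1" 1] x by simp
  then show ?thesis using x by (simp add: minus_equality)
qed

context star_alg_pair
begin

lemma tens_uminus_left: "x \<in> carrier A \<Longrightarrow> y \<in> carrier B \<Longrightarrow> tens (\<ominus>\<^bsub>A\<^esub> x) y = \<ominus>\<^bsub>T\<^esub> tens x y"
  using tens_smult_left[of x y "-1"] star_alg.minus_one_smult[OF star_alg_tensor]
  by (simp add: A.minus_one_smult tens_closed)

lemma tens_uminus_right: "x \<in> carrier A \<Longrightarrow> y \<in> carrier B \<Longrightarrow> tens x (\<ominus>\<^bsub>B\<^esub> y) = \<ominus>\<^bsub>T\<^esub> tens x y"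
  using tens_smult_right[of x y "-1"] star_alg.minus_one_smult[OF star_alg_tensor]
  by (simp add: B.minus_one_smult tens_closed)

text \<open>Moving \<open>a i k\<close> past \<open>a j l\<close> costs
  \<open>eta j i * eta k l\<close> and moving \<open>u k c\<close> past \<open>u l d\<close> costs
  \<open>eta l k\<close>. What remains is \<open>eta j i\<close>, which is independent of the
  summation indices \<open>k\<close> and \<open>l\<close> and so comes out of the double sum. The
  block form survives because the two factors sit in different tensor legs: an adjoint acts on each
  leg without reordering them, as if the entries of \<open>a\<close> and \<open>u\<close>
  commuted.\<close>

lemma sphere_like_tensor:
  assumes a: "group_like \<theta> A a" and u: "sphere_like \<theta> B u"
  shows "sphere_like \<theta> T (\<lambda>i c. \<Oplus>\<^bsub>T\<^esub>j\<in>{1..4}. tens (a i j) (u j c))"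
proof -
  interpret T: star_alg T by (rule star_alg_tensor)
  define w where "w = (\<lambda>i c. \<Oplus>\<^bsub>T\<^esub>j\<in>{1..4}. tens (a i j) (u j c))"
  have qa: "quaternionic A 4 a" and qu: "quaternionic B 2 u"
    using a u unfolding group_like_def sphere_like_def by blast+
  note closed = quaternionic_closed[OF qa] quaternionic_closed[OF qu] tens_closed
  have a_comm: "a i j \<otimes>\<^bsub>A\<^esub> a k l = (eta \<theta> k i * eta \<theta> j l) \<odot>\<^bsub>A\<^esub> (a k l \<otimes>\<^bsub>A\<^esub> a i j)"
    if "i \<in> {1..4}" "j \<in> {1..4}" "k \<in> {1..4}" "l \<in> {1..4}" for i j k l
    using a that unfolding group_like_def by blast
  have u_comm: "u i c \<otimes>\<^bsub>B\<^esub> u j d = eta \<theta> j i \<odot>\<^bsub>B\<^esub> (u j d \<otimes>\<^bsub>B\<^esub> u i c)"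
    if "i \<in> {1..4}" "j \<in> {1..4}" "c \<in> {1..2}" "d \<in> {1..2}" for i j c d
    using u that unfolding sphere_like_def by blast
  have w4: "w i c = tens (a i 1) (u 1 c) \<oplus>\<^bsub>T\<^esub> (tens (a i 2) (u 2 c) \<oplus>\<^bsub>T\<^esub>
      (tens (a i 3) (u 3 c) \<oplus>\<^bsub>T\<^esub> tens (a i 4) (u 4 c)))" if "i \<in> {1..4}" "c \<in> {1..2}" for i c
    unfolding w_def using closed that by (subst T.finsum_1_4) auto
  have w_closed: "w i c \<in> carrier T" if "i \<in> {1..4}" "c \<in> {1..2}" for i c
    using that closed by (simp add: w4)
  have w_block: "w (i + 1) 1 = \<ominus>\<^bsub>T\<^esub> adj T (w i 2) \<and> w (i + 1) 2 = adj T (w i 1)"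
    if i: "i \<in> {1, 3}" for i
  proof -
    have i4: "i \<in> {1..4}" "i + 1 \<in> {1..4}" using i by auto
    have [simp]: "a i 1 \<in> carrier A" "a i 2 \<in> carrier A" "a i 3 \<in> carrier A" "a i 4 \<in> carrier A"
      "u 1 1 \<in> carrier B" "u 1 2 \<in> carrier B" "u 3 1 \<in> carrier B" "u 3 2 \<in> carrier B"
      using i by (auto intro!: closed)
    have a_simps: "a (i + 1) 1 = \<ominus>\<^bsub>A\<^esub> adj A (a i 2)" "a (i + 1) 2 = adj A (a i 1)"
      "a (i + 1) 3 = \<ominus>\<^bsub>A\<^esub> adj A (a i 4)" "a (i + 1) 4 = adj A (a i 3)"
      using qa i unfolding quaternionic_def by auto
    have u_simps: "u 2 1 = \<ominus>\<^bsub>B\<^esub> adj B (u 1 2)" "u 2 2 = adj B (u 1 1)"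
      "u 4 1 = \<ominus>\<^bsub>B\<^esub> adj B (u 3 2)" "u 4 2 = adj B (u 3 1)"
      using qu unfolding quaternionic_def by auto
    \<comment> \<open>Terms 1 and 2 of the row \<open>i + 1\<close> are, up to the sign, the
      adjoints of terms 2 and 1 of the row \<open>i\<close>; likewise 3 and 4. Hence the final
      reordering of the sum.\<close>
    show ?thesis
      by (simp add: i4[THEN w4] a_simps u_simps tens_uminus_left tens_uminus_right tens_closed T.adj_add
          tens_adj T.adj_uminus B.adj_uminus T.minus_add T.minus_minus del: add_Suc_right)
        (simp add: T.a_ac tens_closed)
  qed
  have "quaternionic T 2 w"
    unfolding quaternionic_def
  proof (intro conjI ballI impI)
    fix i j :: nat assume "i \<in> {1, 3}" "j \<in> {1, 3}" "j < 2"
    then have "j = 1" by auto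
    then show "w (i + 1) j = \<ominus>\<^bsub>T\<^esub> adj T (w i (j + 1))" "w (i + 1) (j + 1) = adj T (w i j)"
      using w_block[OF \<open>i \<in> {1, 3}\<close>] by simp_all
  qed (rule w_closed)
  moreover have "w i c \<otimes>\<^bsub>T\<^esub> w j d = eta \<theta> j i \<odot>\<^bsub>T\<^esub> (w j d \<otimes>\<^bsub>T\<^esub> w i c)"
    if ij: "i \<in> {1..4}" "j \<in> {1..4}" and cd: "c \<in> {1..2}" "d \<in> {1..2}" for i j c d
  proof -
    have swap: "tens (a i k) (u k c) \<otimes>\<^bsub>T\<^esub> tens (a j l) (u l d)
        = eta \<theta> j i \<odot>\<^bsub>T\<^esub> (tens (a j l) (u l d) \<otimes>\<^bsub>T\<^esub> tens (a i k) (u k c))"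
      if kl: "k \<in> {1..4}" "l \<in> {1..4}" for k l
    proof -
      let ?a = "a j l \<otimes>\<^bsub>A\<^esub> a i k" and ?u = "u l d \<otimes>\<^bsub>B\<^esub> u k c"
      have [simp]: "?a \<in> carrier A" "?u \<in> carrier B" using closed ij cd kl by auto
      have "tens (a i k) (u k c) \<otimes>\<^bsub>T\<^esub> tens (a j l) (u l d) = tens (a i k \<otimes>\<^bsub>A\<^esub> a j l) (u k c \<otimes>\<^bsub>B\<^esub> u l d)"
        using closed ij cd kl by (intro tens_mult) auto
      also have "\<dots> = tens ((eta \<theta> j i * eta \<theta> k l) \<odot>\<^bsub>A\<^esub> ?a) (eta \<theta> l k \<odot>\<^bsub>B\<^esub> ?u)"
        using ij cd kl by (simp only: a_comm[of i k j l] u_comm[of k l c d])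
      also have "\<dots> = (eta \<theta> j i * (eta \<theta> k l * eta \<theta> l k)) \<odot>\<^bsub>T\<^esub> tens ?a ?u"
        by (simp add: tens_smult_left tens_smult_right T.smult_smult tens_closed mult_ac)
      also have "\<dots> = eta \<theta> j i \<odot>\<^bsub>T\<^esub> tens ?a ?u"
        using kl by (simp add: eta_mult)
      also have "tens ?a ?u = tens (a j l) (u l d) \<otimes>\<^bsub>T\<^esub> tens (a i k) (u k c)"
        using closed ij cd kl by (intro tens_mult[symmetric]) auto
      finally show ?thesis .
    qed
    have "w i c \<otimes>\<^bsub>T\<^esub> w j d
        = (\<Oplus>\<^bsub>T\<^esub>k\<in>{1..4}. \<Oplus>\<^bsub>T\<^esub>l\<in>{1..4}. tens (a i k) (u k c) \<otimes>\<^bsub>T\<^esub> tens (a j l) (u l d))"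
      unfolding w_def using closed ij cd by (intro T.finsum_mult_finsum) auto
    also have "\<dots> = (\<Oplus>\<^bsub>T\<^esub>k\<in>{1..4}. \<Oplus>\<^bsub>T\<^esub>l\<in>{1..4}.
        eta \<theta> j i \<odot>\<^bsub>T\<^esub> (tens (a j l) (u l d) \<otimes>\<^bsub>T\<^esub> tens (a i k) (u k c)))"
      using closed ij cd swap by (intro T.finsum_cong') (auto intro!: T.finsum_closed T.finsum_cong')
    also have "\<dots> = eta \<theta> j i \<odot>\<^bsub>T\<^esub> (\<Oplus>\<^bsub>T\<^esub>k\<in>{1..4}. \<Oplus>\<^bsub>T\<^esub>l\<in>{1..4}.
        tens (a j l) (u l d) \<otimes>\<^bsub>T\<^esub> tens (a i k) (u k c))"
    proof -
      have "(\<Oplus>\<^bsub>T\<^esub>k\<in>{1..4}. \<Oplus>\<^bsub>T\<^esub>l\<in>{1..4}.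
          eta \<theta> j i \<odot>\<^bsub>T\<^esub> (tens (a j l) (u l d) \<otimes>\<^bsub>T\<^esub> tens (a i k) (u k c)))
        = (\<Oplus>\<^bsub>T\<^esub>k\<in>{1..4}. eta \<theta> j i \<odot>\<^bsub>T\<^esub>
            (\<Oplus>\<^bsub>T\<^esub>l\<in>{1..4}. tens (a j l) (u l d) \<otimes>\<^bsub>T\<^esub> tens (a i k) (u k c)))"
        using closed ij cd
        by (intro T.finsum_cong' T.smult_finsum[symmetric]) (auto intro!: T.finsum_closed)
      also have "\<dots> = eta \<theta> j i \<odot>\<^bsub>T\<^esub> (\<Oplus>\<^bsub>T\<^esub>k\<in>{1..4}. \<Oplus>\<^bsub>T\<^esub>l\<in>{1..4}.
          tens (a j l) (u l d) \<otimes>\<^bsub>T\<^esub> tens (a i k) (u k c))"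
        using closed ij cd by (intro T.smult_finsum[symmetric]) (auto intro!: T.finsum_closed)
      finally show ?thesis .
    qed
    \<comment> \<open>After the factors have traded places, the left one is indexed by
      \<open>l\<close>, so \<open>l\<close> has to become the outer index before the product of two
      sums can be recognised.\<close>
    also have "(\<Oplus>\<^bsub>T\<^esub>k\<in>{1..4}. \<Oplus>\<^bsub>T\<^esub>l\<in>{1..4}. tens (a j l) (u l d) \<otimes>\<^bsub>T\<^esub> tens (a i k) (u k c))
        = (\<Oplus>\<^bsub>T\<^esub>l\<in>{1..4}. \<Oplus>\<^bsub>T\<^esub>k\<in>{1..4}. tens (a j l) (u l d) \<otimes>\<^bsub>T\<^esub> tens (a i k) (u k c))"
      using closed ij cd by (intro T.finsum_swap) auto
    also have "\<dots> = w j d \<otimes>\<^bsub>T\<^esub> w i c"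
      unfolding w_def using closed ij cd by (intro T.finsum_mult_finsum[symmetric]) auto
    finally show ?thesis .
  qed
  ultimately show ?thesis
    unfolding sphere_like_def w_def by blast
qed

end

section \<open>The quantum group and the seven-sphere\<close>

lemma group_relators_closed: "group_relators \<theta> \<subseteq> carrier (free_star_algebra UNIV)"
proof -
  interpret F: star_alg "free_star_algebra (UNIV :: group_gen set)" by (rule star_alg_free)
  have "group_matr (free_star_algebra UNIV) free_gen i j \<in> carrier (free_star_algebra UNIV)"
    if "i \<in> {1..4}" "j \<in> {1..4}" for i j
    using quaternionic_closed[OF F.quaternionic_group_matr[of free_gen]] that by simp
  then show ?thesis
    by (auto simp: group_relators_def Let_def)
qed

lemma sphere_relators_closed: "sphere_relators \<theta> \<subseteq> carrier (free_star_algebra UNIV)"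
proof -
  interpret F: star_alg "free_star_algebra (UNIV :: sphere_gen set)" by (rule star_alg_free)
  have "sphere_matr (free_star_algebra UNIV) free_gen i j \<in> carrier (free_star_algebra UNIV)"
    if "i \<in> {1..4}" "j \<in> {1..2}" for i j
    using quaternionic_closed[OF F.quaternionic_sphere_matr[of free_gen]] that by simp
  then show ?thesis
    by (auto simp: sphere_relators_def Let_def intro!: F.minus_closed F.finsum_closed F.m_closed)
qed

lemma presented_relation:
  assumes "R \<subseteq> carrier (free_star_algebra X)" "f \<ominus>\<^bsub>free_star_algebra X\<^esub> g \<in> R"
    and "f \<in> carrier (free_star_algebra X)" "g \<in> carrier (free_star_algebra X)"
  shows "star_ideal_gen (free_star_algebra X) R +>\<^bsub>free_star_algebra X\<^esub> f
    = star_ideal_gen (free_star_algebra X) R +>\<^bsub>free_star_algebra X\<^esub> g"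
  using star_alg_hom.hom_eq_if_minus_eq_zero[OF presented_hom(1)] presented_hom(3) assms by blast

lemma M_alg_star_alg: "star_alg (M_alg \<theta>)"
  and M_matr_group_like: "group_like \<theta> (M_alg \<theta>) (M_matr \<theta>)"
proof -
  let ?F = "free_star_algebra (UNIV :: group_gen set)"
  define p where "p = (+>\<^bsub>?F\<^esub>) (star_ideal_gen ?F (group_relators \<theta>))"
  note presented = presented_hom[OF group_relators_closed[of \<theta>]]
  interpret p: star_alg_hom ?F "M_alg \<theta>" p
    unfolding p_def M_alg_def by (rule presented)
  show "star_alg (M_alg \<theta>)" by (rule p.B.star_alg_axioms)
  let ?a = "group_matr ?F free_gen"
  have p_gen: "p (free_gen x) = presented_gen UNIV (group_relators \<theta>) x" for x
    unfolding p_def by (rule presented)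
  have quat: "quaternionic (M_alg \<theta>) 4 (M_matr \<theta>)"
    unfolding M_matr_def p_gen[symmetric]
    by (rule p.B.quaternionic_group_matr) simp
  have a_closed: "?a i j \<in> carrier ?F" if "i \<in> {1..4}" "j \<in> {1..4}" for i j
    using quaternionic_closed[OF p.A.quaternionic_group_matr[of free_gen]] that by simp
  have p_a: "p (?a i j) = M_matr \<theta> i j" if "i \<in> {1..4}" "j \<in> {1..4}" for i j
    using that by (simp add: p.hom_group_matr p_gen M_matr_def)
  have "M_matr \<theta> i j \<otimes>\<^bsub>M_alg \<theta>\<^esub> M_matr \<theta> k l
      = (eta \<theta> k i * eta \<theta> j l) \<odot>\<^bsub>M_alg \<theta>\<^esub> (M_matr \<theta> k l \<otimes>\<^bsub>M_alg \<theta>\<^esub> M_matr \<theta> i j)"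
    if "i \<in> {1..4}" "j \<in> {1..4}" "k \<in> {1..4}" "l \<in> {1..4}" for i j k l
  proof -
    have "?a i j \<otimes>\<^bsub>?F\<^esub> ?a k l \<ominus>\<^bsub>?F\<^esub> (eta \<theta> k i * eta \<theta> j l) \<odot>\<^bsub>?F\<^esub> (?a k l \<otimes>\<^bsub>?F\<^esub> ?a i j) \<in> group_relators \<theta>"
      using that unfolding group_relators_def Let_def by blast
    then have "p (?a i j \<otimes>\<^bsub>?F\<^esub> ?a k l) = p ((eta \<theta> k i * eta \<theta> j l) \<odot>\<^bsub>?F\<^esub> (?a k l \<otimes>\<^bsub>?F\<^esub> ?a i j))"
      unfolding p_def using a_closed that by (intro presented_relation[OF group_relators_closed]) auto
    then show ?thesis
      using that by (simp add: a_closed p_a)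
  qed
  then show "group_like \<theta> (M_alg \<theta>) (M_matr \<theta>)"
    using quat unfolding group_like_def by blast
qed

text \<open>The generator of the determinant ideal must first be placed in the carrier, which holds
  as permutations keep the column indices in \<open>{1..4}\<close>. The relations of the matrix then
  pass through the projection.\<close>

lemma SL_alg_star_alg: "star_alg (SL_alg \<theta>)"
  and SL_matr_group_like: "group_like \<theta> (SL_alg \<theta>) (SL_matr \<theta>)"
proof -
  interpret M: star_alg "M_alg \<theta>" by (rule M_alg_star_alg)
  have a_closed: "M_matr \<theta> i j \<in> carrier (M_alg \<theta>)" if "i \<in> {1..4}" "j \<in> {1..4}" for i j
    using M_matr_group_like that unfolding group_like_def by (blast dest: quaternionic_closed)
  have "M_det \<theta> \<in> carrier (M_alg \<theta>)"
    unfolding M_det_def Let_def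
  proof (intro M.finsum_closed Pi_I, drule CollectD)
    fix \<sigma> :: "nat \<Rightarrow> nat" assume "\<sigma> permutes {1..4}"
    then have "M_matr \<theta> k (\<sigma> k) \<in> carrier (M_alg \<theta>)" if "k \<in> {1..4}" for k
      using a_closed that permutes_in_image by metis
    from this[of 1] this[of 2] this[of 3] this[of 4]
    show "(of_int (sign \<sigma>) * eps \<theta> [\<sigma> 1, \<sigma> 2, \<sigma> 3, \<sigma> 4]) \<odot>\<^bsub>M_alg \<theta>\<^esub>
      (M_matr \<theta> 1 (\<sigma> 1) \<otimes>\<^bsub>M_alg \<theta>\<^esub> M_matr \<theta> 2 (\<sigma> 2) \<otimes>\<^bsub>M_alg \<theta>\<^esub> M_matr \<theta> 3 (\<sigma> 3) \<otimes>\<^bsub>M_alg \<theta>\<^esub>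
        M_matr \<theta> 4 (\<sigma> 4)) \<in> carrier (M_alg \<theta>)"
      by simp
  qed
  then have "{M_det \<theta> \<ominus>\<^bsub>M_alg \<theta>\<^esub> \<one>\<^bsub>M_alg \<theta>\<^esub>} \<subseteq> carrier (M_alg \<theta>)" by simp
  from M.quot_gen_hom(1)[OF this]
  interpret p: star_alg_hom "M_alg \<theta>" "SL_alg \<theta>" "(+>\<^bsub>M_alg \<theta>\<^esub>) (SL_ideal \<theta>)"
    unfolding SL_alg_def SL_ideal_def .
  show "star_alg (SL_alg \<theta>)" by (rule p.B.star_alg_axioms)
  show "group_like \<theta> (SL_alg \<theta>) (SL_matr \<theta>)"
    unfolding SL_matr_def by (rule p.hom_group_like[OF M_matr_group_like])
qed

text \<open>The normalisation sums \<open>adj z z\<close> over the four generators, while the first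
  column of \<open>u\<close> has squared norm
  \<open>adj z1 z1 + z2 adj z2 + adj z3 z3 + z4 adj z4\<close>. The two agree once \<open>z2\<close>
  and \<open>z4\<close> are known to be normal.\<close>

lemma S7_alg_star_alg: "star_alg (S7_alg \<theta>)"
  and S7_matr_sphere_like: "sphere_like \<theta> (S7_alg \<theta>) (S7_matr \<theta>)"
  and S7_matr_isometry: "a \<in> {1..2} \<Longrightarrow> b \<in> {1..2} \<Longrightarrow>
    matr_mult 4 (S7_alg \<theta>) (matr_adj (S7_alg \<theta>) (S7_matr \<theta>)) (S7_matr \<theta>) a b
      = (if a = b then \<one>\<^bsub>S7_alg \<theta>\<^esub> else \<zero>\<^bsub>S7_alg \<theta>\<^esub>)"
proof -
  let ?F = "free_star_algebra (UNIV :: sphere_gen set)"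
  let ?S = "S7_alg \<theta>"
  define p where "p = (+>\<^bsub>?F\<^esub>) (star_ideal_gen ?F (sphere_relators \<theta>))"
  note presented = presented_hom[OF sphere_relators_closed[of \<theta>]]
  interpret p: star_alg_hom ?F ?S p
    unfolding p_def S7_alg_def by (rule presented)
  show "star_alg ?S" by (rule p.B.star_alg_axioms)
  let ?u = "sphere_matr ?F free_gen"
  have p_gen: "p (free_gen x) = presented_gen UNIV (sphere_relators \<theta>) x" for x
    unfolding p_def by (rule presented)
  have quat: "quaternionic ?S 2 (S7_matr \<theta>)"
    unfolding S7_matr_def p_gen[symmetric]
    by (rule p.B.quaternionic_sphere_matr) simp
  have u_closed: "?u i j \<in> carrier ?F" if "i \<in> {1..4}" "j \<in> {1..2}" for i j
    using quaternionic_closed[OF p.A.quaternionic_sphere_matr[of free_gen]] that by simp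
  have p_u: "p (?u i j) = S7_matr \<theta> i j" if "i \<in> {1..4}" "j \<in> {1..2}" for i j
    using that by (simp add: p.hom_sphere_matr p_gen S7_matr_def)
  have "S7_matr \<theta> i a \<otimes>\<^bsub>?S\<^esub> S7_matr \<theta> j b = eta \<theta> j i \<odot>\<^bsub>?S\<^esub> (S7_matr \<theta> j b \<otimes>\<^bsub>?S\<^esub> S7_matr \<theta> i a)"
    if "i \<in> {1..4}" "j \<in> {1..4}" "a \<in> {1..2}" "b \<in> {1..2}" for i j a b
  proof -
    have "?u i a \<otimes>\<^bsub>?F\<^esub> ?u j b \<ominus>\<^bsub>?F\<^esub> eta \<theta> j i \<odot>\<^bsub>?F\<^esub> (?u j b \<otimes>\<^bsub>?F\<^esub> ?u i a) \<in> sphere_relators \<theta>"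
      using that unfolding sphere_relators_def Let_def by blast
    then have "p (?u i a \<otimes>\<^bsub>?F\<^esub> ?u j b) = p (eta \<theta> j i \<odot>\<^bsub>?F\<^esub> (?u j b \<otimes>\<^bsub>?F\<^esub> ?u i a))"
      unfolding p_def using u_closed that by (intro presented_relation[OF sphere_relators_closed]) auto
    then show ?thesis
      using that by (simp add: u_closed p_u)
  qed
  then show sphere: "sphere_like \<theta> ?S (S7_matr \<theta>)"
    using quat unfolding sphere_like_def by blast
  define z where "z = (\<lambda>x. p (free_gen x))"
  have z_closed [simp]: "z x \<in> carrier ?S" for x by (simp add: z_def)
  have u_simps: "S7_matr \<theta> 1 1 = z Z1" "S7_matr \<theta> 1 2 = z Z2" "S7_matr \<theta> 3 1 = z Z3" "S7_matr \<theta> 3 2 = z Z4"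
    "S7_matr \<theta> 2 1 = \<ominus>\<^bsub>?S\<^esub> adj ?S (z Z2)" "S7_matr \<theta> 4 1 = \<ominus>\<^bsub>?S\<^esub> adj ?S (z Z4)"
    by (simp_all add: S7_matr_def z_def p_gen sphere_matr_def from_rows_def Let_def)
  \<comment> \<open>As \<open>u 2 1\<close> is minus the adjoint of \<open>u 1 2\<close>, and
    \<open>u 4 1\<close> minus that of \<open>u 3 2\<close>, these two relations with phase 1
    express the normality of \<open>z2\<close> and \<open>z4\<close>.\<close>
  have "S7_matr \<theta> 1 2 \<otimes>\<^bsub>?S\<^esub> S7_matr \<theta> 2 1 = S7_matr \<theta> 2 1 \<otimes>\<^bsub>?S\<^esub> S7_matr \<theta> 1 2"
    "S7_matr \<theta> 3 2 \<otimes>\<^bsub>?S\<^esub> S7_matr \<theta> 4 1 = S7_matr \<theta> 4 1 \<otimes>\<^bsub>?S\<^esub> S7_matr \<theta> 3 2"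
    using sphere[unfolded sphere_like_def, THEN conjunct2, rule_format, of 1 2 2 1]
      sphere[unfolded sphere_like_def, THEN conjunct2, rule_format, of 3 4 2 1]
      quaternionic_closed[OF quat]
    by (simp_all add: eta_diagonal_block)
  then have z_comm: "\<ominus>\<^bsub>?S\<^esub> (z Z2 \<otimes>\<^bsub>?S\<^esub> adj ?S (z Z2)) = \<ominus>\<^bsub>?S\<^esub> (adj ?S (z Z2) \<otimes>\<^bsub>?S\<^esub> z Z2)"
    "\<ominus>\<^bsub>?S\<^esub> (z Z4 \<otimes>\<^bsub>?S\<^esub> adj ?S (z Z4)) = \<ominus>\<^bsub>?S\<^esub> (adj ?S (z Z4) \<otimes>\<^bsub>?S\<^esub> z Z4)"
    by (simp_all add: u_simps p.B.l_minus p.B.r_minus)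
  have "(\<Oplus>\<^bsub>?S\<^esub>k\<in>{1..4}. adj ?S (S7_matr \<theta> k 1) \<otimes>\<^bsub>?S\<^esub> S7_matr \<theta> k 1)
      = adj ?S (z Z1) \<otimes>\<^bsub>?S\<^esub> z Z1 \<oplus>\<^bsub>?S\<^esub> (adj ?S (z Z2) \<otimes>\<^bsub>?S\<^esub> z Z2
        \<oplus>\<^bsub>?S\<^esub> (adj ?S (z Z3) \<otimes>\<^bsub>?S\<^esub> z Z3 \<oplus>\<^bsub>?S\<^esub> adj ?S (z Z4) \<otimes>\<^bsub>?S\<^esub> z Z4))"
    using quaternionic_closed[OF quat]
    by (subst p.B.finsum_1_4) (auto simp: u_simps p.B.adj_uminus p.B.l_minus p.B.r_minus z_comm)
  also have "\<dots> = p (\<Oplus>\<^bsub>?F\<^esub>z\<in>{Z1, Z2, Z3, Z4}. adj ?F (free_gen z) \<otimes>\<^bsub>?F\<^esub> free_gen z)"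
    by (simp add: z_def)
  also have "\<dots> = p \<one>\<^bsub>?F\<^esub>"
    unfolding p_def
    by (intro presented_relation[OF sphere_relators_closed])
      (auto simp: sphere_relators_def Let_def intro!: p.A.finsum_closed p.A.m_closed)
  finally have "(\<Oplus>\<^bsub>?S\<^esub>k\<in>{1..4}. adj ?S (S7_matr \<theta> k 1) \<otimes>\<^bsub>?S\<^esub> S7_matr \<theta> k 1) = \<one>\<^bsub>?S\<^esub>"
    by simp
  then show "a \<in> {1..2} \<Longrightarrow> b \<in> {1..2} \<Longrightarrow>
    matr_mult 4 ?S (matr_adj ?S (S7_matr \<theta>)) (S7_matr \<theta>) a b = (if a = b then \<one>\<^bsub>?S\<^esub> else \<zero>\<^bsub>?S\<^esub>)"
    using p.B.sphere_like_gram[OF sphere] by simp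
qed

section \<open>The family of projections\<close>

lemma SL_S7_alg_star_alg: "star_alg (SL_S7_alg \<theta>)"
  and ut_matr_sphere_like: "sphere_like \<theta> (SL_S7_alg \<theta>) (ut_matr \<theta>)"
proof -
  interpret star_alg_pair "SL_alg \<theta>" "S7_alg \<theta>"
    by (intro star_alg_pair.intro SL_alg_star_alg S7_alg_star_alg)
  show "star_alg (SL_S7_alg \<theta>)"
    unfolding SL_S7_alg_def by (rule star_alg_tensor)
  show "sphere_like \<theta> (SL_S7_alg \<theta>) (ut_matr \<theta>)"
    unfolding SL_S7_alg_def ut_matr_def
    by (rule sphere_like_tensor[OF SL_matr_group_like S7_matr_sphere_like])
qed

lemma ut_matr_closed: "i \<in> {1..4} \<Longrightarrow> a \<in> {1..2} \<Longrightarrow> ut_matr \<theta> i a \<in> carrier (SL_S7_alg \<theta>)"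
  using ut_matr_sphere_like quaternionic_closed unfolding sphere_like_def by blast

lemma S7_matr_closed: "i \<in> {1..4} \<Longrightarrow> a \<in> {1..2} \<Longrightarrow> S7_matr \<theta> i a \<in> carrier (S7_alg \<theta>)"
  using S7_matr_sphere_like quaternionic_closed unfolding sphere_like_def by blast

lemma SL_matr_closed: "i \<in> {1..4} \<Longrightarrow> j \<in> {1..4} \<Longrightarrow> SL_matr \<theta> i j \<in> carrier (SL_alg \<theta>)"
  using SL_matr_group_like quaternionic_closed unfolding group_like_def by blast

lemma S7t_carrier_star_subalgebra: "star_subalgebra (S7t_carrier \<theta>) (SL_S7_alg \<theta>)"
  unfolding S7t_carrier_def
  using ut_matr_closed by (intro star_alg.star_subalgebra_gen[OF SL_S7_alg_star_alg]) blast

lemma ut_matr_in_S7t: "i \<in> {1..4} \<Longrightarrow> a \<in> {1..2} \<Longrightarrow> ut_matr \<theta> i a \<in> S7t_carrier \<theta>"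
  unfolding S7t_carrier_def
  by (rule subsetD[OF star_alg.star_subalgebra_gen_superset[OF SL_S7_alg_star_alg]]) blast

text \<open>\<open>rho2\<close> is defined by the entry in position 1, 1 alone; that it governs all
  four entries is the orthogonality of the columns.\<close>

lemma ut_matr_gram:
  "a \<in> {1..2} \<Longrightarrow> b \<in> {1..2} \<Longrightarrow>
    matr_mult 4 (SL_S7_alg \<theta>) (matr_adj (SL_S7_alg \<theta>) (ut_matr \<theta>)) (ut_matr \<theta>) a b
      = (if a = b then rho2 \<theta> else \<zero>\<^bsub>SL_S7_alg \<theta>\<^esub>)"
  using star_alg.sphere_like_gram[OF SL_S7_alg_star_alg ut_matr_sphere_like]
  by (simp add: rho2_def Let_def)

lemma rho2_closed: "rho2 \<theta> \<in> carrier (SL_S7_alg \<theta>)"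
proof -
  interpret T: star_alg "SL_S7_alg \<theta>" by (rule SL_S7_alg_star_alg)
  show ?thesis
    unfolding rho2_def Let_def using ut_matr_closed by (intro T.finsum_closed) auto
qed

lemma adjoin_SL_S7: "adjoin (SL_S7_alg \<theta>) (S7t_carrier \<theta>) (rho2 \<theta>)"
  by (intro adjoin.intro adjoin_axioms.intro SL_S7_alg_star_alg rho2_closed
      star_subalgebra_subset[OF S7t_carrier_star_subalgebra])

lemma ext_emb_hom: "star_alg_hom (SL_S7_alg \<theta>) (SL_S7_ext_alg \<theta>) (ext_emb \<theta>)"
  unfolding SL_S7_ext_alg_def ext_emb_def by (rule adjoin.adjoin_emb_hom[OF adjoin_SL_S7])

lemma
  shows rho_inv_closed: "rho_inv \<theta> \<in> carrier (SL_S7_ext_alg \<theta>)"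
    and adj_rho_inv: "adj (SL_S7_ext_alg \<theta>) (rho_inv \<theta>) = rho_inv \<theta>"
    and rho_inv_commute: "x \<in> S7t_carrier \<theta> \<Longrightarrow>
      rho_inv \<theta> \<otimes>\<^bsub>SL_S7_ext_alg \<theta>\<^esub> ext_emb \<theta> x = ext_emb \<theta> x \<otimes>\<^bsub>SL_S7_ext_alg \<theta>\<^esub> rho_inv \<theta>"
    and rho_inv_square: "(rho_inv \<theta> \<otimes>\<^bsub>SL_S7_ext_alg \<theta>\<^esub> rho_inv \<theta>) \<otimes>\<^bsub>SL_S7_ext_alg \<theta>\<^esub> ext_emb \<theta> (rho2 \<theta>)
      = \<one>\<^bsub>SL_S7_ext_alg \<theta>\<^esub>"
  unfolding SL_S7_ext_alg_def ext_emb_def rho_inv_def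
  using adjoin.adjoin_emb_root(2-5)[OF adjoin_SL_S7] by auto

lemma p_matr_closed: "i \<in> {1..4} \<Longrightarrow> j \<in> {1..4} \<Longrightarrow> p_matr \<theta> i j \<in> carrier (S7_alg \<theta>)"
proof -
  interpret S: star_alg "S7_alg \<theta>" by (rule S7_alg_star_alg)
  show "i \<in> {1..4} \<Longrightarrow> j \<in> {1..4} \<Longrightarrow> p_matr \<theta> i j \<in> carrier (S7_alg \<theta>)"
    unfolding p_matr_def Let_def using S7_matr_closed by (intro S.finsum_closed) auto
qed

lemma S4_carrier_star_subalgebra: "star_subalgebra (S4_carrier \<theta>) (S7_alg \<theta>)"
  unfolding S4_carrier_def
  using p_matr_closed by (intro star_alg.star_subalgebra_gen[OF S7_alg_star_alg]) blast

lemma p_matr_in_S4: "i \<in> {1..4} \<Longrightarrow> j \<in> {1..4} \<Longrightarrow> p_matr \<theta> i j \<in> S4_carrier \<theta>"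
  unfolding S4_carrier_def
  by (rule subsetD[OF star_alg.star_subalgebra_gen_superset[OF S7_alg_star_alg]]) blast

theorem lemma5p3:
  fixes \<theta> :: real
  shows "murray_von_neumann_equiv 4 (SL_S4_ext_alg \<theta>) (P_matr \<theta>) (one_tensor_p \<theta>)"
proof -
  let ?S = "S7_alg \<theta>" and ?T = "SL_S7_alg \<theta>" and ?E = "SL_S7_ext_alg \<theta>"
  let ?e = "ext_emb \<theta>" and ?r = "rho_inv \<theta>" and ?ut = "ut_matr \<theta>" and ?u = "S7_matr \<theta>"
  let ?t = "tensor_elem (SL_alg \<theta>) ?S"
  let ?one = "\<one>\<^bsub>SL_alg \<theta>\<^esub>"
  interpret pair: star_alg_pair "SL_alg \<theta>" ?S
    by (intro star_alg_pair.intro SL_alg_star_alg S7_alg_star_alg)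
  interpret e: star_alg_hom ?T ?E ?e by (rule ext_emb_hom)
  note pair_facts [folded SL_S7_alg_def] =
    pair.tens_closed pair.tens_mult pair.tens_add_right pair.star_alg_hom_tens_one
    pair.tensor_subalgebra_closed
  interpret t: star_alg_hom ?S ?T "?t ?one" by (rule pair_facts(4))
  note r_closed [simp] = rho_inv_closed[of \<theta>]
  \<comment> \<open>\<open>rho_inv\<close> must also pass the adjoints of the entries, and these lie
    in the commuting set because that set is a star-subalgebra.\<close>
  have utC: "?ut i a \<in> S7t_carrier \<theta>" "adj ?T (?ut i a) \<in> S7t_carrier \<theta>"
    if "i \<in> {1..4}" "a \<in> {1..2}" for i a
    using ut_matr_in_S7t[OF that] S7t_carrier_star_subalgebra[of \<theta>] by (auto simp: star_subalgebra_def)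

  define B where "B = star_subalgebra_gen ?E
    (insert ?r (?e ` tensor_subalgebra (SL_alg \<theta>) ?S (S4_carrier \<theta>)))"
  have S4_sub: "S4_carrier \<theta> \<subseteq> carrier ?S"
    by (rule star_subalgebra_subset[OF S4_carrier_star_subalgebra])
  have gen_sub: "insert ?r (?e ` tensor_subalgebra (SL_alg \<theta>) ?S (S4_carrier \<theta>)) \<subseteq> carrier ?E"
    using pair_facts(5)[OF S4_sub] by auto
  have B: "star_subalgebra B ?E"
    unfolding B_def by (rule e.B.star_subalgebra_gen[OF gen_sub])
  have B_gen: "?r \<in> B" "\<And>x y. x \<in> carrier (SL_alg \<theta>) \<Longrightarrow> y \<in> S4_carrier \<theta> \<Longrightarrow> ?e (?t x y) \<in> B"
    unfolding B_def
    by (rule subsetD[OF e.B.star_subalgebra_gen_superset], simp add: pair.tens_in_tensor_subalgebra)+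
  have subring: "subring B ?E" using B by (simp add: star_subalgebra_def)

  define W where "W = (\<lambda>i a. ?r \<otimes>\<^bsub>?E\<^esub> ?e (?ut i a))"
  define U where "U = (\<lambda>i a. ?e (?t ?one (?u i a)))"
  note closed = ut_matr_closed[of _ _ \<theta>] S7_matr_closed[of _ _ \<theta>] SL_matr_closed[of _ _ \<theta>]
    p_matr_closed[of _ _ \<theta>] rho2_closed[of \<theta>]
  have eut: "?e (?ut i a) \<in> carrier ?E" "?r \<otimes>\<^bsub>?E\<^esub> ?e (?ut i a) = ?e (?ut i a) \<otimes>\<^bsub>?E\<^esub> ?r"
      "adj ?E (?e (?ut i a)) \<in> carrier ?E"
      "adj ?E (?e (?ut i a)) \<otimes>\<^bsub>?E\<^esub> ?r = ?r \<otimes>\<^bsub>?E\<^esub> adj ?E (?e (?ut i a))"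
    if "i \<in> {1..4}" "a \<in> {1..2}" for i a
    using closed(1)[OF that] rho_inv_commute[OF utC(1)[OF that]] rho_inv_commute[OF utC(2)[OF that]] by simp_all
  have adjW: "adj ?E (W i a) = ?r \<otimes>\<^bsub>?E\<^esub> adj ?E (?e (?ut i a))" if "i \<in> {1..4}" "a \<in> {1..2}" for i a
    using eut[OF that] by (simp add: W_def e.B.adj_mult adj_rho_inv)
  \<comment> \<open>Applied with \<open>x\<close> an entry of \<open>ut\<close> or the adjoint of
    one, to collect the two factors \<open>rho_inv\<close> in front.\<close>
  have r_move: "(?r \<otimes>\<^bsub>?E\<^esub> x) \<otimes>\<^bsub>?E\<^esub> (?r \<otimes>\<^bsub>?E\<^esub> y) = (?r \<otimes>\<^bsub>?E\<^esub> ?r) \<otimes>\<^bsub>?E\<^esub> (x \<otimes>\<^bsub>?E\<^esub> y)"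
    if "x \<otimes>\<^bsub>?E\<^esub> ?r = ?r \<otimes>\<^bsub>?E\<^esub> x" "x \<in> carrier ?E" "y \<in> carrier ?E" for x y
  proof -
    have "(?r \<otimes>\<^bsub>?E\<^esub> x) \<otimes>\<^bsub>?E\<^esub> (?r \<otimes>\<^bsub>?E\<^esub> y) = ?r \<otimes>\<^bsub>?E\<^esub> ((x \<otimes>\<^bsub>?E\<^esub> ?r) \<otimes>\<^bsub>?E\<^esub> y)"
      using that(2,3) by (simp add: e.B.m_assoc)
    also have "\<dots> = (?r \<otimes>\<^bsub>?E\<^esub> ?r) \<otimes>\<^bsub>?E\<^esub> (x \<otimes>\<^bsub>?E\<^esub> y)"
      unfolding that(1) using that(2,3) by (simp add: e.B.m_assoc)
    finally show ?thesis .
  qed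
  have rr_closed: "?r \<otimes>\<^bsub>?E\<^esub> ?r \<in> carrier ?E" by simp

  have W: "W i a \<in> carrier ?E" if "i \<in> {1..4}" "a \<in> {1..2}" for i a
    using eut[OF that] by (simp add: W_def)
  have U: "U i a \<in> carrier ?E" if "i \<in> {1..4}" "a \<in> {1..2}" for i a
    using closed(2)[OF that] by (simp add: U_def)

  have WW: "matr_mult 4 ?E (matr_adj ?E W) W a b = (if a = b then \<one>\<^bsub>?E\<^esub> else \<zero>\<^bsub>?E\<^esub>)"
    if ab: "a \<in> {1..2}" "b \<in> {1..2}" for a b
  proof -
    have "matr_mult 4 ?E (matr_adj ?E W) W a b
        = (\<Oplus>\<^bsub>?E\<^esub>k\<in>{1..4}. (?r \<otimes>\<^bsub>?E\<^esub> ?r) \<otimes>\<^bsub>?E\<^esub> (adj ?E (?e (?ut k a)) \<otimes>\<^bsub>?E\<^esub> ?e (?ut k b)))"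
      unfolding matr_mult_def matr_adj_def
    proof (intro e.B.finsum_cong' refl Pi_I)
      fix k :: nat assume k: "k \<in> {1..4}"
      show "adj ?E (W k a) \<otimes>\<^bsub>?E\<^esub> W k b = (?r \<otimes>\<^bsub>?E\<^esub> ?r) \<otimes>\<^bsub>?E\<^esub> (adj ?E (?e (?ut k a)) \<otimes>\<^bsub>?E\<^esub> ?e (?ut k b))"
        using eut[OF k ab(1)] eut(1)[OF k ab(2)] unfolding adjW[OF k ab(1)] unfolding W_def by (intro r_move)
      show "(?r \<otimes>\<^bsub>?E\<^esub> ?r) \<otimes>\<^bsub>?E\<^esub> (adj ?E (?e (?ut k a)) \<otimes>\<^bsub>?E\<^esub> ?e (?ut k b)) \<in> carrier ?E"
        using eut[OF k ab(1)] eut(1)[OF k ab(2)] by simp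
    qed
    also have "\<dots> = (?r \<otimes>\<^bsub>?E\<^esub> ?r) \<otimes>\<^bsub>?E\<^esub> (\<Oplus>\<^bsub>?E\<^esub>k\<in>{1..4}. adj ?E (?e (?ut k a)) \<otimes>\<^bsub>?E\<^esub> ?e (?ut k b))"
      using eut ab by (intro e.B.finsum_rdistr[symmetric]) auto
    also have "(\<Oplus>\<^bsub>?E\<^esub>k\<in>{1..4}. adj ?E (?e (?ut k a)) \<otimes>\<^bsub>?E\<^esub> ?e (?ut k b))
        = ?e (matr_mult 4 ?T (matr_adj ?T ?ut) ?ut a b)"
    proof -
      have "?e (matr_mult 4 ?T (matr_adj ?T ?ut) ?ut a b)
          = (\<Oplus>\<^bsub>?E\<^esub>k\<in>{1..4}. ?e (adj ?T (?ut k a) \<otimes>\<^bsub>?T\<^esub> ?ut k b))"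
        unfolding matr_mult_def matr_adj_def using closed(1) ab by (subst e.hom_finsum) (auto simp: comp_def)
      also have "\<dots> = (\<Oplus>\<^bsub>?E\<^esub>k\<in>{1..4}. adj ?E (?e (?ut k a)) \<otimes>\<^bsub>?E\<^esub> ?e (?ut k b))"
        using closed(1) eut ab by (intro e.B.finsum_cong') simp_all
      finally show ?thesis ..
    qed
    \<comment> \<open>On the diagonal \<open>rho_inv\<close> squared cancels \<open>rho2\<close>;
      off the diagonal the image of zero remains.\<close>
    also have "(?r \<otimes>\<^bsub>?E\<^esub> ?r) \<otimes>\<^bsub>?E\<^esub> \<dots> = (if a = b then \<one>\<^bsub>?E\<^esub> else \<zero>\<^bsub>?E\<^esub>)"
      using rho_inv_square rr_closed by (simp only: ut_matr_gram[OF ab] e.hom_zero e.B.r_null split: if_split) simp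
    finally show ?thesis .
  qed

  have UU: "matr_mult 4 ?E (matr_adj ?E U) U a b = (if a = b then \<one>\<^bsub>?E\<^esub> else \<zero>\<^bsub>?E\<^esub>)"
    if ab: "a \<in> {1..2}" "b \<in> {1..2}" for a b
  proof -
    have "?e (?t ?one (matr_mult 4 ?S (matr_adj ?S ?u) ?u a b))
        = (\<Oplus>\<^bsub>?E\<^esub>k\<in>{1..4}. ?e (?t ?one (adj ?S (?u k a) \<otimes>\<^bsub>?S\<^esub> ?u k b)))"
      unfolding matr_mult_def matr_adj_def using closed(2) ab
      by (subst t.hom_finsum, simp, subst e.hom_finsum) (auto simp: comp_def)
    also have "\<dots> = matr_mult 4 ?E (matr_adj ?E U) U a b"
      unfolding matr_mult_def matr_adj_def U_def
      using closed(2) ab by (intro e.B.finsum_cong') simp_all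
    finally show ?thesis
      by (simp add: S7_matr_isometry[OF ab] split: if_splits)
  qed

  have UU': "matr_mult 2 ?E U (matr_adj ?E U) i j = one_tensor_p \<theta> i j"
    if ij: "i \<in> {1..4}" "j \<in> {1..4}" for i j
  proof -
    have "one_tensor_p \<theta> i j = (\<Oplus>\<^bsub>?E\<^esub>a\<in>{1..2}. ?e (?t ?one (?u i a \<otimes>\<^bsub>?S\<^esub> adj ?S (?u j a))))"
      unfolding one_tensor_p_def p_matr_def Let_def using closed(2) ij
      by (subst t.hom_finsum, simp, subst e.hom_finsum) (auto simp: comp_def)
    also have "\<dots> = matr_mult 2 ?E U (matr_adj ?E U) i j"
      unfolding matr_mult_def matr_adj_def U_def
      using closed(2) ij by (intro e.B.finsum_cong') simp_all
    finally show ?thesis ..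
  qed

  have WW': "matr_mult 2 ?E W (matr_adj ?E W) i j = P_matr \<theta> i j"
    if ij: "i \<in> {1..4}" "j \<in> {1..4}" for i j
  proof -
    have "matr_mult 2 ?E W (matr_adj ?E W) i j
        = (\<Oplus>\<^bsub>?E\<^esub>a\<in>{1..2}. (?r \<otimes>\<^bsub>?E\<^esub> ?r) \<otimes>\<^bsub>?E\<^esub> (?e (?ut i a) \<otimes>\<^bsub>?E\<^esub> adj ?E (?e (?ut j a))))"
      unfolding matr_mult_def matr_adj_def
    proof (intro e.B.finsum_cong' refl Pi_I)
      fix a :: nat assume a: "a \<in> {1..2}"
      show "W i a \<otimes>\<^bsub>?E\<^esub> adj ?E (W j a) = (?r \<otimes>\<^bsub>?E\<^esub> ?r) \<otimes>\<^bsub>?E\<^esub> (?e (?ut i a) \<otimes>\<^bsub>?E\<^esub> adj ?E (?e (?ut j a)))"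
        using eut(1)[OF ij(1) a] eut(2)[OF ij(1) a, symmetric] eut(3)[OF ij(2) a]
        unfolding adjW[OF ij(2) a] unfolding W_def by (intro r_move)
      show "(?r \<otimes>\<^bsub>?E\<^esub> ?r) \<otimes>\<^bsub>?E\<^esub> (?e (?ut i a) \<otimes>\<^bsub>?E\<^esub> adj ?E (?e (?ut j a))) \<in> carrier ?E"
        using eut(1)[OF ij(1) a] eut(3)[OF ij(2) a] by simp
    qed
    also have "\<dots> = P_matr \<theta> i j"
      unfolding P_matr_def Let_def using eut ij by (intro e.B.finsum_rdistr[symmetric]) auto
    finally show ?thesis .
  qed

  have V: "matr_mult 2 ?E W (matr_adj ?E U) i l \<in> B"
    if il: "i \<in> {1..4}" "l \<in> {1..4}" for i l
  proof -
    \<comment> \<open>Right multiplication by \<open>1 \<otimes> adj u\<close> changes the second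
      tensor leg only, so it acts on each summand of \<open>ut\<close> separately.\<close>
    have prod: "?e (?ut i a) \<otimes>\<^bsub>?E\<^esub> adj ?E (U l a)
        = ?e (\<Oplus>\<^bsub>?T\<^esub>j\<in>{1..4}. ?t (SL_matr \<theta> i j) (?u j a \<otimes>\<^bsub>?S\<^esub> adj ?S (?u l a)))"
      if a: "a \<in> {1..2}" for a
    proof -
      have "?e (?ut i a) \<otimes>\<^bsub>?E\<^esub> adj ?E (U l a) = ?e (?ut i a \<otimes>\<^bsub>?T\<^esub> ?t ?one (adj ?S (?u l a)))"
        using closed(1)[OF il(1) a] closed(2)[OF il(2) a] by (simp add: U_def)
      also have "?ut i a \<otimes>\<^bsub>?T\<^esub> ?t ?one (adj ?S (?u l a))
          = (\<Oplus>\<^bsub>?T\<^esub>j\<in>{1..4}. ?t (SL_matr \<theta> i j) (?u j a) \<otimes>\<^bsub>?T\<^esub> ?t ?one (adj ?S (?u l a)))"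
        unfolding ut_matr_def using il a closed(2,3) pair_facts(1) by (intro e.A.finsum_ldistr) auto
      also have "\<dots> = (\<Oplus>\<^bsub>?T\<^esub>j\<in>{1..4}. ?t (SL_matr \<theta> i j) (?u j a \<otimes>\<^bsub>?S\<^esub> adj ?S (?u l a)))"
        using il a closed(2,3) pair_facts(1) by (intro e.A.finsum_cong') (simp_all add: pair_facts(2) Pi_iff del: t.hom_adj)
      finally show ?thesis .
    qed
    have "matr_mult 2 ?E W (matr_adj ?E U) i l
        = (\<Oplus>\<^bsub>?E\<^esub>a\<in>{1..2}. ?r \<otimes>\<^bsub>?E\<^esub> (?e (?ut i a) \<otimes>\<^bsub>?E\<^esub> adj ?E (U l a)))"
      unfolding matr_mult_def matr_adj_def W_def
      using eut(1) U il by (intro e.B.finsum_cong') (simp_all add: e.B.m_assoc Pi_iff)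
    also have "\<dots> = ?r \<otimes>\<^bsub>?E\<^esub> (\<Oplus>\<^bsub>?E\<^esub>a\<in>{1..2}. ?e (?ut i a) \<otimes>\<^bsub>?E\<^esub> adj ?E (U l a))"
      using eut U il by (intro e.B.finsum_rdistr[symmetric]) auto
    also have "(\<Oplus>\<^bsub>?E\<^esub>a\<in>{1..2}. ?e (?ut i a) \<otimes>\<^bsub>?E\<^esub> adj ?E (U l a))
        = (\<Oplus>\<^bsub>?E\<^esub>j\<in>{1..4}. ?e (?t (SL_matr \<theta> i j) (p_matr \<theta> j l)))"
    proof -
      let ?f = "\<lambda>a j. ?t (SL_matr \<theta> i j) (?u j a \<otimes>\<^bsub>?S\<^esub> adj ?S (?u l a))"
      have f: "?f a j \<in> carrier ?T" if "a \<in> {1..2}" "j \<in> {1..4}" for a j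
        using il that closed(2,3) by (intro pair_facts(1)) auto
      have "(\<Oplus>\<^bsub>?E\<^esub>a\<in>{1..2}. ?e (?ut i a) \<otimes>\<^bsub>?E\<^esub> adj ?E (U l a)) = (\<Oplus>\<^bsub>?E\<^esub>a\<in>{1..2}. \<Oplus>\<^bsub>?E\<^esub>j\<in>{1..4}. ?e (?f a j))"
      proof (intro e.B.finsum_cong' refl Pi_I)
        fix a :: nat assume a: "a \<in> {1..2}"
        show "?e (?ut i a) \<otimes>\<^bsub>?E\<^esub> adj ?E (U l a) = (\<Oplus>\<^bsub>?E\<^esub>j\<in>{1..4}. ?e (?f a j))"
          unfolding prod[OF a] using f a by (subst e.hom_finsum) (auto simp: comp_def)
        show "(\<Oplus>\<^bsub>?E\<^esub>j\<in>{1..4}. ?e (?f a j)) \<in> carrier ?E"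
          using f a by (intro e.B.finsum_closed) auto
      qed
      \<comment> \<open>With the sum over the columns \<open>a\<close> innermost, the first leg
        \<open>A i j\<close> is constant in it and additivity in the second leg assembles
        \<open>p j l\<close>. This is where \<open>u\<close> disappears from \<open>V\<close> in
        favour of \<open>p\<close>.\<close>
      also have "\<dots> = (\<Oplus>\<^bsub>?E\<^esub>j\<in>{1..4}. \<Oplus>\<^bsub>?E\<^esub>a\<in>{1..2}. ?e (?f a j))"
        using f by (intro e.B.finsum_swap) auto
      also have "\<dots> = (\<Oplus>\<^bsub>?E\<^esub>j\<in>{1..4}. ?e (?t (SL_matr \<theta> i j) (p_matr \<theta> j l)))"
      proof (intro e.B.finsum_cong' refl Pi_I)
        fix j :: nat assume j: "j \<in> {1..4}"
        have p: "p_matr \<theta> j l = ?u j 1 \<otimes>\<^bsub>?S\<^esub> adj ?S (?u l 1) \<oplus>\<^bsub>?S\<^esub> ?u j 2 \<otimes>\<^bsub>?S\<^esub> adj ?S (?u l 2)"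
          unfolding p_matr_def Let_def using closed(2) il j
          by (subst pair.B.finsum_1_2) auto
        have "(\<Oplus>\<^bsub>?E\<^esub>a\<in>{1..2}. ?e (?f a j)) = ?e (?f 1 j) \<oplus>\<^bsub>?E\<^esub> ?e (?f 2 j)"
          using f j by (intro e.B.finsum_1_2) auto
        also have "\<dots> = ?e (?f 1 j \<oplus>\<^bsub>?T\<^esub> ?f 2 j)"
          using f j by simp
        also have "?f 1 j \<oplus>\<^bsub>?T\<^esub> ?f 2 j = ?t (SL_matr \<theta> i j) (p_matr \<theta> j l)"
          unfolding p using closed(2,3) il j by (intro pair_facts(3)[symmetric]) auto
        finally show "(\<Oplus>\<^bsub>?E\<^esub>a\<in>{1..2}. ?e (?f a j)) = ?e (?t (SL_matr \<theta> i j) (p_matr \<theta> j l))" .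
        show "?e (?t (SL_matr \<theta> i j) (p_matr \<theta> j l)) \<in> carrier ?E"
          using il j closed(3,4) pair_facts(1) by simp
      qed
      finally show ?thesis .
    qed
    \<comment> \<open>\<open>rho_inv\<close> and every summand are among the generators of
      \<open>B\<close>, which is closed under sums and products.\<close>
    also have "?r \<otimes>\<^bsub>?E\<^esub> \<dots> \<in> B"
      using il closed(3) p_matr_in_S4
      by (intro subringE(6)[OF subring] B_gen e.B.finsum_subring(2)[OF subring]) (auto intro!: B_gen)
    finally show ?thesis .
  qed

  have "SL_S4_ext_alg \<theta> = ?E\<lparr>carrier := B\<rparr>"
    by (simp add: SL_S4_ext_alg_def B_def Let_def)
  then show ?thesis
    using e.B.murray_von_neumann_equiv_isometries[OF B, of 4 2 W U "P_matr \<theta>" "one_tensor_p \<theta>"]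
      W U WW UU V WW' UU' by simp
qed

end
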